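(* Let $\Lambda\subset\mathbb{C}$ be such that the system of exponentials $\{e^{i\lambda t}\}_{\lambda\in\Lambda}$ is incomplete in $L^2(-\pi,\pi)$. Then there exists a sequence $S\subset\mathbb{R}$ with $\Lambda\cap S=\emptyset$ such that the system $\{e^{i\lambda t}\}_{\lambda\in\Lambda\cup S}$ is complete and minimal in $L^2(-\pi,\pi)$.
   Context: For $\lambda\in\mathbb{C}$, $e^{i\lambda t}$ denotes the function $t\mapsto e^{i\lambda t}$ regarded as an element of $L^2(-\pi,\pi)$. A system $\{v_j\}_{j\in J}$ in a Hilbert space $H$ is complete if its closed linear span equals $H$, and incomplete otherwise; it is minimal if no $v_{j_0}$ belongs to the closed linear span of $\{v_j\}_{j\in J\setminus\{j_0\}}$. The sequences $\Lambda$ and $S$ are sets of distinct points, and the sequence $S$ may be finite or infinite. *)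

theory Defs
  imports "HOL-Complex_Analysis.Complex_Analysis"
begin

text \<open>
  Elements of \<open>L\<^sup>2(M)\<close> are represented by functions rather than by classes modulo equality
  almost everywhere. Accordingly \<open>L2_norm\<close> is only a seminorm, and a closed linear span
  contains, with a function, all square-integrable functions that agree with it almost everywhere.
\<close>

definition L2_space :: "'a measure \<Rightarrow> ('a \<Rightarrow> complex) set" where
  "L2_space M = {f \<in> borel_measurable M. integrable M (\<lambda>t. (cmod (f t))\<^sup>2)}"

definition L2_norm :: "'a measure \<Rightarrow> ('a \<Rightarrow> complex) \<Rightarrow> real" where
  "L2_norm M f = sqrt (LINT t|M. (cmod (f t))\<^sup>2)"

definition lin_span :: "('j \<Rightarrow> 'a \<Rightarrow> complex) \<Rightarrow> 'j set \<Rightarrow> ('a \<Rightarrow> complex) set" where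
  "lin_span v J = {\<lambda>t. \<Sum>j\<in>F. c j * v j t | F c. finite F \<and> F \<subseteq> J}"

text \<open>
  The following notions are meant for systems \<open>v\<close> in \<open>L2_space M\<close>: outside of that space
  \<open>L2_norm\<close> may be \<open>0\<close> because the integral does not exist. Lemma \<open>expi_in_L2\<close> below shows
  that exponential systems are of this kind.
\<close>

definition L2_closed_span ::
  "'a measure \<Rightarrow> ('j \<Rightarrow> 'a \<Rightarrow> complex) \<Rightarrow> 'j set \<Rightarrow> ('a \<Rightarrow> complex) set" where
  "L2_closed_span M v J =
     {f \<in> L2_space M. \<forall>\<epsilon>>0. \<exists>g\<in>lin_span v J. L2_norm M (\<lambda>t. f t - g t) < \<epsilon>}"

definition L2_complete :: "'a measure \<Rightarrow> ('j \<Rightarrow> 'a \<Rightarrow> complex) \<Rightarrow> 'j set \<Rightarrow> bool" where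
  "L2_complete M v J \<longleftrightarrow> L2_closed_span M v J = L2_space M"

definition L2_minimal :: "'a measure \<Rightarrow> ('j \<Rightarrow> 'a \<Rightarrow> complex) \<Rightarrow> 'j set \<Rightarrow> bool" where
  "L2_minimal M v J \<longleftrightarrow> (\<forall>j\<in>J. v j \<notin> L2_closed_span M v (J - {j}))"

definition expi :: "complex \<Rightarrow> real \<Rightarrow> complex" where
  "expi z t = exp (\<i> * z * of_real t)"

abbreviation leb_pi :: "real measure" where
  "leb_pi \<equiv> lebesgue_on {-pi<..<pi}"

lemma expi_in_L2: "expi z \<in> L2_space leb_pi"
proof -
  have cont: "continuous_on A (expi z)" for A
    unfolding expi_def by (intro continuous_intros)
  have "continuous_on {-pi..pi} (\<lambda>t. (cmod (expi z t))\<^sup>2)"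
    by (intro continuous_intros cont)
  then have "integrable (lebesgue_on {-pi..pi}) (\<lambda>t. (cmod (expi z t))\<^sup>2)"
    by (rule continuous_imp_integrable_real)
  then have "integrable leb_pi (\<lambda>t. (cmod (expi z t))\<^sup>2)"
    using set_integrable_subset[of lebesgue "{-pi..pi}" "\<lambda>t. (cmod (expi z t))\<^sup>2" "{-pi<..<pi}"]
    by (simp add: set_integrable_def integrable_restrict_space greaterThanLessThan_subseteq_atLeastAtMost_iff)
  moreover have "expi z \<in> borel_measurable leb_pi"
    by (rule continuous_imp_measurable_on_sets_lebesgue[OF cont]) auto
  ultimately show ?thesis
    by (simp add: L2_space_def)
qed

end

theory Submission
  imports Defs
begin

text \<open>
  Those Fourier transforms of functions in \<open>L\<^sup>2(-\<pi>, \<pi>)\<close> that vanish on \<open>\<Lambda>\<close> form a nonzero Hilbert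
  space \<open>H\<close> of entire functions in which zeros outside of \<open>\<Lambda>\<close> can be divided out and multiplication by
  \<open>z\<close> is symmetric (it is \<open>i d/dt\<close> on functions vanishing at \<open>\<plusminus>\<pi>\<close>). The set \<open>S\<close> is the spectrum of
  a self-adjoint extension of this multiplication, as in de Branges' theory. Let \<open>k\<close> be the reproducing
  kernel of \<open>H\<close> at a real point \<open>s\<close> and let \<open>\<Phi>(z) = (z - s) k(z)\<close>; for all but countably many \<open>s\<close>
  the zeros of \<open>\<Phi>\<close> are simple, and those outside of \<open>\<Lambda>\<close> are real. Let \<open>S\<close> consist of the latter.
  If \<open>F \<in> H\<close> vanishes on \<open>S\<close>, then \<open>F = h \<Phi>\<close> with \<open>h\<close> entire, and
  \<open>\<Phi>(z) (h(z) - h(w)) / (z - w)\<close> is the value at \<open>z\<close> of the resolvent at \<open>w\<close> applied to \<open>F\<close>. Its norm is at most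
  \<open>\<parallel>F\<parallel> / \<bar>Im w\<bar>\<close>, so \<open>h\<close> is constant by Liouville's theorem. As \<open>\<Phi>\<close> lies in \<open>H\<close> for
  only exceptional \<open>s\<close>, a suitable choice of \<open>s\<close> gives \<open>F = 0\<close>, which is completeness.
  Minimality follows from exchanging zeros in \<open>\<Phi> / (z - \<sigma>) \<in> H\<close> for \<open>\<sigma> \<in> S\<close>.
\<close>

subsection \<open>Entire functions\<close>

text \<open>The bound degenerates on the real axis. On the circle of radius \<open>R\<close> about
  0, however, \<open>w^2 - R^2\<close> has modulus \<open>2 * R * \<bar>Im w\<bar>\<close>, so its
  product with \<open>h w - a\<close> is bounded on the whole circle. The maximum principle carries
  the bound inside, and Liouville's theorem applies.\<close>

lemma entire_constantI:
  fixes h :: "complex \<Rightarrow> complex"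
  assumes hol: "h holomorphic_on UNIV"
    and bound: "\<And>w. \<bar>Im w\<bar> * cmod (h w - a) \<le> C * (1 + cmod w)"
  shows "h constant_on UNIV"
proof (rule Liouville_theorem[OF hol])
  have "cmod (h w - a) \<le> 16/3 * C" for w
  proof -
    \<comment> \<open>The factor 2 keeps the modulus of \<open>w^2 - R^2\<close> at the given
      \<open>w\<close> at least \<open>3/4 * R^2\<close>. From \<open>R \<ge> 1\<close> follows
      \<open>1 + R \<le> 2 * R\<close>, so that the powers of \<open>R\<close> cancel in the
      end.\<close>
    define R where "R = max 1 (2 * cmod w)"
    have R: "R \<ge> 1" "cmod w \<le> R/2" by (auto simp: R_def)
    have "0 \<le> C" using bound[of 0] by simp
    have "cmod ((w\<^sup>2 - of_real (R\<^sup>2)) * (h w - a)) \<le> 2 * R * (C * (1 + R))"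
    proof (rule maximum_modulus_frontier[where S="ball 0 R" and \<xi>=w
          and f="\<lambda>w. (w\<^sup>2 - of_real (R\<^sup>2)) * (h w - a)"])
      show "(\<lambda>w. (w\<^sup>2 - complex_of_real (R\<^sup>2)) * (h w - a)) holomorphic_on interior (ball 0 R)"
        by (intro holomorphic_intros holomorphic_on_subset[OF hol]) auto
      show "continuous_on (closure (ball 0 R)) (\<lambda>w. (w\<^sup>2 - complex_of_real (R\<^sup>2)) * (h w - a))"
        by (intro continuous_intros holomorphic_on_imp_continuous_on holomorphic_on_subset[OF hol]) auto
      fix z :: complex assume "z \<in> frontier (ball 0 R)"
      then have z: "cmod z = R" using R by simp
      have "z\<^sup>2 - of_real (R\<^sup>2) = z * (z - cnj z)"
        using complex_norm_square[of z] unfolding z by (simp add: power2_eq_square right_diff_distrib)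
      then have "cmod (z\<^sup>2 - of_real (R\<^sup>2)) = 2 * R * \<bar>Im z\<bar>"
        using z by (simp add: norm_mult complex_diff_cnj)
      then have "cmod ((z\<^sup>2 - of_real (R\<^sup>2)) * (h z - a)) = 2 * R * (\<bar>Im z\<bar> * cmod (h z - a))"
        by (simp add: norm_mult)
      also have "\<dots> \<le> 2 * R * (C * (1 + R))"
        using bound[of z] z R by (intro mult_left_mono) auto
      finally show "cmod ((z\<^sup>2 - of_real (R\<^sup>2)) * (h z - a)) \<le> 2 * R * (C * (1 + R))" .
    qed (use R in auto)
    moreover have "cmod (w\<^sup>2 - of_real (R\<^sup>2)) \<ge> 3/4 * R\<^sup>2"
    proof -
      have "cmod (of_real (R\<^sup>2)) - cmod (w\<^sup>2) \<le> cmod (w\<^sup>2 - of_real (R\<^sup>2))"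
        by (metis norm_minus_commute norm_triangle_ineq2)
      moreover have "cmod (w\<^sup>2) \<le> R\<^sup>2 / 4"
        using power_mono[OF R(2), of 2] by (simp add: norm_power power_divide)
      moreover have "cmod (of_real (R\<^sup>2)) = R\<^sup>2"
        by (metis abs_of_nonneg norm_of_real zero_le_power2)
      ultimately show ?thesis by linarith
    qed
    ultimately have "3/4 * R\<^sup>2 * cmod (h w - a) \<le> 2 * R * (C * (1 + R))"
      by (smt (verit, best) mult_right_mono norm_ge_zero norm_mult)
    then have "R * (3/4 * R * cmod (h w - a)) \<le> R * (2 * (C * (1 + R)))"
      by (simp add: power2_eq_square algebra_simps)
    then have "3/4 * R * cmod (h w - a) \<le> 2 * (C * (1 + R))"
      by (rule mult_left_le_imp_le) (use R in linarith)
    also have "\<dots> \<le> 2 * (C * (R + R))"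
      using R \<open>0 \<le> C\<close> by (intro mult_left_mono) auto
    finally have "R * (3/4 * cmod (h w - a)) \<le> R * (4 * C)" by (simp add: algebra_simps)
    then have "3/4 * cmod (h w - a) \<le> 4 * C"
      by (rule mult_left_le_imp_le) (use R in linarith)
    then show ?thesis by simp
  qed
  then have "cmod (h w) \<le> 16/3 * C + cmod a" for w
    by (smt (verit) norm_triangle_ineq2)
  then show "bounded (range h)"
    by (auto simp: bounded_iff)
qed

text \<open>Only a zero \<open>z\<close> of \<open>p\<close> is delicate. Near it
  \<open>f / p\<close> is the quotient of the difference quotients \<open>f1\<close> and
  \<open>p1\<close>, which are entire because their singularity is removable, and
  \<open>p1 z = deriv p z \<noteq> 0\<close>.\<close>

lemma entire_quotient_simple_zeros:
  fixes f p :: "complex \<Rightarrow> complex"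
  assumes f: "f holomorphic_on UNIV" and p: "p holomorphic_on UNIV"
    and zeros: "\<And>z. p z = 0 \<Longrightarrow> f z = 0 \<and> deriv p z \<noteq> 0"
  obtains h where "h holomorphic_on UNIV" "\<And>z. f z = h z * p z"
proof
  define h where "h z = (if p z = 0 then deriv f z / deriv p z else f z / p z)" for z
  show "f z = h z * p z" for z using zeros[of z] by (auto simp: h_def)
  have "h field_differentiable at z" for z
  proof (cases "p z = 0")
    case False
    have "continuous_on UNIV p"
      using p holomorphic_on_imp_continuous_on by blast
    then have op: "open {z. p z \<noteq> 0}"
      by (simp add: open_Collect_neq)
    have "(\<lambda>z. f z / p z) holomorphic_on {z. p z \<noteq> 0}"
      by (intro holomorphic_intros holomorphic_on_subset[OF f] holomorphic_on_subset[OF p]) auto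
    then have "h holomorphic_on {z. p z \<noteq> 0}"
      by (rule holomorphic_transform) (auto simp: h_def)
    with op False show ?thesis
      using holomorphic_on_imp_differentiable_at by blast
  next
    case True
    define f1 where "f1 = (\<lambda>u. if u = z then deriv f z else (f u - f z)/(u-z))"
    define p1 where "p1 = (\<lambda>u. if u = z then deriv p z else (p u - p z)/(u-z))"
    have hf1: "f1 holomorphic_on UNIV" and hp1: "p1 holomorphic_on UNIV"
      unfolding f1_def p1_def by (rule pole_lemma_open; use f p in simp)+
    have "continuous_on UNIV p1"
      using hp1 holomorphic_on_imp_continuous_on by blast
    then have op: "open {u. p1 u \<noteq> 0}"
      by (simp add: open_Collect_neq)
    have zin: "z \<in> {u. p1 u \<noteq> 0}" using True zeros by (simp add: p1_def)
    have "(\<lambda>z. f1 z / p1 z) holomorphic_on {u. p1 u \<noteq> 0}"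
      by (intro holomorphic_intros holomorphic_on_subset[OF hf1] holomorphic_on_subset[OF hp1]) auto
    then have "h holomorphic_on {u. p1 u \<noteq> 0}"
      by (rule holomorphic_transform) (use True zeros[OF True] in \<open>auto simp: h_def p1_def f1_def\<close>)
    with op zin show ?thesis
      using holomorphic_on_imp_differentiable_at by blast
  qed
  then show "h holomorphic_on UNIV"
    by (simp add: holomorphic_on_def)
qed

lemma countable_zeros_entire:
  assumes "f holomorphic_on UNIV" "f z \<noteq> 0"
  shows "countable {z::complex. f z = 0}"
  using holomorphic_countable_equal_UNIV[of f "\<lambda>_. 0"] assms by auto

text \<open>A nonzero entire function has only countably many zeros. The lemma serves to cancel a
  linear factor in identities between entire functions.\<close>

lemma entire_eq_0I:
  fixes f :: "complex \<Rightarrow> complex"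
  assumes "f holomorphic_on UNIV" and zero: "\<And>z. z \<noteq> a \<Longrightarrow> f z = 0"
  shows "f z = 0"
proof (rule ccontr)
  assume "f z \<noteq> 0"
  with assms(1) have "countable (insert a {z. f z = 0})"
    using countable_zeros_entire by auto
  moreover have "insert a {z. f z = 0} = UNIV" using zero by auto
  ultimately show False using uncountable_UNIV_complex by simp
qed

subsection \<open>Semi-inner product spaces of functions\<close>

text \<open>The form is only semidefinite because elements are functions rather than classes modulo
  null sets. Closure and linearity are stated for the single shape \<open>a * f t + b * g t\<close>;
  coefficients \<open>1\<close>, \<open>-1\<close> and \<open>0\<close> in later terms serve to
  match it.\<close>

locale semi_inner_space =
  fixes V :: "('a \<Rightarrow> complex) set" and ip :: "('a \<Rightarrow> complex) \<Rightarrow> ('a \<Rightarrow> complex) \<Rightarrow> complex"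
  assumes lincomb: "f \<in> V \<Longrightarrow> g \<in> V \<Longrightarrow> (\<lambda>t. a * f t + b * g t) \<in> V"
    and ip_lincomb: "f \<in> V \<Longrightarrow> g \<in> V \<Longrightarrow> h \<in> V \<Longrightarrow>
      ip (\<lambda>t. a * f t + b * g t) h = a * ip f h + b * ip g h"
    and ip_commute: "f \<in> V \<Longrightarrow> g \<in> V \<Longrightarrow> ip g f = cnj (ip f g)"
    and ip_nonneg: "f \<in> V \<Longrightarrow> 0 \<le> Re (ip f f)"
begin

definition nrm :: "('a \<Rightarrow> complex) \<Rightarrow> real" where
  "nrm f = sqrt (Re (ip f f))"

lemma ip_lincomb_right:
  assumes "f \<in> V" "g \<in> V" "h \<in> V"
  shows "ip h (\<lambda>t. a * f t + b * g t) = cnj a * ip h f + cnj b * ip h g"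
  using assms by (simp add: ip_commute[of _ h] lincomb ip_lincomb)

lemma nrm_nonneg: "f \<in> V \<Longrightarrow> 0 \<le> nrm f"
  by (simp add: nrm_def ip_nonneg)

lemma ip_self: "f \<in> V \<Longrightarrow> ip f f = of_real ((nrm f)\<^sup>2)"
  using ip_commute[of f f] by (auto simp: nrm_def ip_nonneg complex_eq_iff)

lemma nrm_lincomb_square:
  assumes "f \<in> V" "g \<in> V"
  shows "(nrm (\<lambda>t. a * f t + b * g t))\<^sup>2 =
    (cmod a)\<^sup>2 * (nrm f)\<^sup>2 + 2 * Re (a * cnj b * ip f g) + (cmod b)\<^sup>2 * (nrm g)\<^sup>2"
proof -
  have "complex_of_real ((nrm (\<lambda>t. a * f t + b * g t))\<^sup>2) =
     ip (\<lambda>t. a * f t + b * g t) (\<lambda>t. a * f t + b * g t)"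
    using assms by (simp add: ip_self lincomb)
  also have "\<dots> = a * cnj a * ip f f + a * cnj b * ip f g + b * cnj a * cnj (ip f g) + b * cnj b * ip g g"
    using assms by (simp add: ip_lincomb_right ip_lincomb lincomb ip_commute[of f g] algebra_simps)
  also have "\<dots> = of_real ((cmod a)\<^sup>2 * (nrm f)\<^sup>2 + (cmod b)\<^sup>2 * (nrm g)\<^sup>2) +
       (a * cnj b * ip f g + cnj (a * cnj b * ip f g))"
    using assms by (simp add: ip_self flip: complex_norm_square)
  finally have "complex_of_real ((nrm (\<lambda>t. a * f t + b * g t))\<^sup>2) =
     of_real ((cmod a)\<^sup>2 * (nrm f)\<^sup>2 + (cmod b)\<^sup>2 * (nrm g)\<^sup>2 + 2 * Re (a * cnj b * ip f g))"
    unfolding complex_add_cnj by simp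
  then have "(nrm (\<lambda>t. a * f t + b * g t))\<^sup>2 =
      (cmod a)\<^sup>2 * (nrm f)\<^sup>2 + (cmod b)\<^sup>2 * (nrm g)\<^sup>2 + 2 * Re (a * cnj b * ip f g)"
    by (simp only: of_real_eq_iff)
  then show ?thesis by simp
qed

text \<open>With \<open>c = ip f g\<close>, the square norm of \<open>f - t * c * g\<close> is a
  nonnegative real polynomial in \<open>t\<close>. Its value at \<open>t = 1 / (nrm g)^2\<close>
  gives the inequality.\<close>

lemma ip_Cauchy_Schwarz:
  assumes f: "f \<in> V" and g: "g \<in> V"
  shows "cmod (ip f g) \<le> nrm f * nrm g"
proof -
  let ?c = "ip f g"
  have *: "0 \<le> (nrm f)\<^sup>2 - 2 * t * (cmod ?c)\<^sup>2 + t\<^sup>2 * (cmod ?c)\<^sup>2 * (nrm g)\<^sup>2" for t :: real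
  proof -
    have "Re (1 * cnj (- (of_real t * ?c)) * ?c) = - (t * (cmod ?c)\<^sup>2)"
      unfolding cmod_power2 by (simp add: power2_eq_square algebra_simps)
    moreover have "(cmod (- (of_real t * ?c)))\<^sup>2 = t\<^sup>2 * (cmod ?c)\<^sup>2"
      by (simp add: norm_mult power_mult_distrib)
    ultimately have "(nrm (\<lambda>u. 1 * f u + - (of_real t * ?c) * g u))\<^sup>2 =
        (nrm f)\<^sup>2 - 2 * t * (cmod ?c)\<^sup>2 + t\<^sup>2 * (cmod ?c)\<^sup>2 * (nrm g)\<^sup>2"
      unfolding nrm_lincomb_square[OF f g] by simp
    then show ?thesis by (metis zero_le_power2)
  qed
  show ?thesis
  proof (cases "nrm g = 0")
    case True
    have "cmod ?c = 0"
    proof (rule ccontr)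
      assume "cmod ?c \<noteq> 0"
      \<comment> \<open>For \<open>nrm g = 0\<close> the polynomial is affine in \<open>t\<close>,
        and this value of \<open>t\<close> makes it negative.\<close>
      then show False
        using *[of "((nrm f)\<^sup>2 + 1) / (cmod ?c)\<^sup>2"] True by (simp) (smt (verit) zero_le_power2)
    qed
    then show ?thesis using True by simp
  next
    case False
    then have "0 \<le> (nrm f)\<^sup>2 - (cmod ?c)\<^sup>2 / (nrm g)\<^sup>2"
      using *[of "1 / (nrm g)\<^sup>2"] by (simp add: field_simps power2_eq_square)
    then have "(cmod ?c)\<^sup>2 \<le> (nrm f * nrm g)\<^sup>2"
      using False by (simp add: field_simps power_mult_distrib)
    then show ?thesis
      using nrm_nonneg[OF f] nrm_nonneg[OF g] by (meson mult_nonneg_nonneg power2_le_imp_le)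
  qed
qed

lemma nrm_triangle:
  assumes "f \<in> V" "g \<in> V"
  shows "nrm (\<lambda>t. f t + g t) \<le> nrm f + nrm g"
proof (rule power2_le_imp_le)
  have "(nrm (\<lambda>t. f t + g t))\<^sup>2 = (nrm f)\<^sup>2 + 2 * Re (ip f g) + (nrm g)\<^sup>2"
    using nrm_lincomb_square[OF assms, of 1 1] by simp
  also have "\<dots> \<le> (nrm f)\<^sup>2 + 2 * (nrm f * nrm g) + (nrm g)\<^sup>2"
    using ip_Cauchy_Schwarz[OF assms] complex_Re_le_cmod[of "ip f g"] by linarith
  also have "\<dots> = (nrm f + nrm g)\<^sup>2" by (simp add: power2_eq_square algebra_simps)
  finally show "(nrm (\<lambda>t. f t + g t))\<^sup>2 \<le> (nrm f + nrm g)\<^sup>2" .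
qed (use assms nrm_nonneg in auto)

lemma minus_in: "f \<in> V \<Longrightarrow> g \<in> V \<Longrightarrow> (\<lambda>t. f t - g t) \<in> V"
  using lincomb[of f g 1 "-1"] by simp

text \<open>If \<open>ip u g\<close> were nonzero, subtracting a small positive multiple of
  \<open>ip u g * g\<close> would lower the norm: the gain is linear in the multiple, the loss
  quadratic.\<close>

lemma orthogonal_if_minimal:
  assumes u: "u \<in> V" and g: "g \<in> V" and min: "\<And>a. nrm u \<le> nrm (\<lambda>t. u t - a * g t)"
  shows "ip u g = 0"
proof (rule ccontr)
  let ?c = "ip u g"
  assume c: "?c \<noteq> 0"
  \<comment> \<open>The summand 1 makes \<open>t\<close> well defined for \<open>nrm g = 0\<close>
    and gives \<open>t * (nrm g)^2 < 1\<close>, so that the linear term dominates.\<close>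
  define t where "t = 1 / ((nrm g)\<^sup>2 + 1)"
  have t: "t > 0" "t * (nrm g)\<^sup>2 < 1"
  proof -
    have pos: "0 < (nrm g)\<^sup>2 + 1" by (simp add: add_nonneg_pos)
    then show "t > 0" by (simp add: t_def)
    show "t * (nrm g)\<^sup>2 < 1" using pos by (simp add: t_def pos_divide_less_eq)
  qed
  have "Re (1 * cnj (- (of_real t * ?c)) * ?c) = - (t * (cmod ?c)\<^sup>2)"
    unfolding cmod_power2 by (simp add: power2_eq_square algebra_simps)
  moreover have "(cmod (- (of_real t * ?c)))\<^sup>2 = t\<^sup>2 * (cmod ?c)\<^sup>2"
    by (simp add: norm_mult power_mult_distrib)
  ultimately have "(nrm (\<lambda>x. 1 * u x + - (of_real t * ?c) * g x))\<^sup>2 =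
      (nrm u)\<^sup>2 - 2 * t * (cmod ?c)\<^sup>2 + t\<^sup>2 * (cmod ?c)\<^sup>2 * (nrm g)\<^sup>2"
    unfolding nrm_lincomb_square[OF u g] by simp
  moreover have "(nrm u)\<^sup>2 \<le> (nrm (\<lambda>x. 1 * u x + - (of_real t * ?c) * g x))\<^sup>2"
    using min[of "of_real t * ?c"] nrm_nonneg[OF u] by (intro power_mono) auto
  ultimately have "2 * (t * (cmod ?c)\<^sup>2) \<le> (t * (nrm g)\<^sup>2) * (t * (cmod ?c)\<^sup>2)"
    by (simp add: power2_eq_square algebra_simps)
  also have "\<dots> \<le> 1 * (t * (cmod ?c)\<^sup>2)"
    using t by (intro mult_right_mono) auto
  finally have "t * (cmod ?c)\<^sup>2 \<le> 0" by simp
  then show False using t c by (simp add: mult_le_0_iff)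
qed

text \<open>\<open>p\<close> is a point of the closure of \<open>W\<close> nearest to
  \<open>f\<close>, found as the limit of a minimizing sequence. Completeness is an assumption on
  sequences with a geometric rate, the form in which \<open>L2_Cauchy_limit\<close> provides
  it.\<close>

lemma projection:
  assumes W: "W \<subseteq> V" "W \<noteq> {}"
    and Wlin: "\<And>f g a b. f \<in> W \<Longrightarrow> g \<in> W \<Longrightarrow> (\<lambda>t. a * f t + b * g t) \<in> W"
    and f: "f \<in> V"
    and complete: "\<And>g. (\<And>n. g n \<in> V) \<Longrightarrow>
      (\<And>n m. n \<le> m \<Longrightarrow> nrm (\<lambda>t. g m t - g n t) \<le> (1/2) ^ n) \<Longrightarrow>
      \<exists>p\<in>V. \<forall>n. nrm (\<lambda>t. p t - g n t) \<le> (1/2) ^ n"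
  shows "\<exists>p\<in>V. (\<forall>\<epsilon>>0. \<exists>g\<in>W. nrm (\<lambda>t. p t - g t) < \<epsilon>) \<and> (\<forall>g\<in>W. ip (\<lambda>t. f t - p t) g = 0)"
proof -
  have WV: "g \<in> V" if "g \<in> W" for g using that W by auto
  define d where "d = Inf ((\<lambda>g. (nrm (\<lambda>t. f t - g t))\<^sup>2) ` W)"
  have bdd: "bdd_below ((\<lambda>g. (nrm (\<lambda>t. f t - g t))\<^sup>2) ` W)"
    by (rule bdd_belowI[of _ 0]) auto
  have dle: "d \<le> (nrm (\<lambda>t. f t - g t))\<^sup>2" if "g \<in> W" for g
    unfolding d_def using bdd that by (intro cInf_lower) auto
  have d0: "0 \<le> d" unfolding d_def using W(2) by (intro cInf_greatest) auto
  \<comment> \<open>The tolerance is chosen so that the parallelogram law turns it into distances of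
    at most \<open>(1/2) ^ n\<close>.\<close>
  have "\<exists>g\<in>W. (nrm (\<lambda>t. f t - g t))\<^sup>2 < d + (1/4) ^ n / 4" for n :: nat
    using cInf_lessD[of "(\<lambda>g. (nrm (\<lambda>t. f t - g t))\<^sup>2) ` W" "d + (1/4) ^ n / 4"] W(2)
    by (auto simp: d_def[symmetric])
  then obtain g where g: "\<And>n. g n \<in> W" "\<And>n. (nrm (\<lambda>t. f t - g n t))\<^sup>2 < d + (1/4) ^ n / 4"
    by metis
  have cau: "nrm (\<lambda>t. g m t - g n t) \<le> (1/2) ^ n" if "n \<le> m" for n m
  proof (rule power2_le_imp_le)
    let ?x = "\<lambda>t. f t - g n t" and ?y = "\<lambda>t. f t - g m t"
    have x: "?x \<in> V" and y: "?y \<in> V" using f g WV minus_in by auto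
    \<comment> \<open>The midpoint of \<open>g n\<close> and \<open>g m\<close> lies in
      \<open>W\<close>, so its square distance from \<open>f\<close> is at least
      \<open>d\<close>.\<close>
    have "(\<lambda>t. (1/2) * g n t + (1/2) * g m t) \<in> W" by (intro Wlin g)
    from dle[OF this] have "d \<le> (nrm (\<lambda>t. (1/2) * ?x t + (1/2) * ?y t))\<^sup>2"
      by (simp add: algebra_simps)
    also have "\<dots> = (nrm ?x)\<^sup>2 / 4 + Re (ip ?x ?y) / 2 + (nrm ?y)\<^sup>2 / 4"
      unfolding nrm_lincomb_square[OF x y] by (simp add: power2_eq_square)
    finally have 1: "4 * d \<le> (nrm ?x)\<^sup>2 + 2 * Re (ip ?x ?y) + (nrm ?y)\<^sup>2" by simp
    have "(nrm (\<lambda>t. g m t - g n t))\<^sup>2 = (nrm (\<lambda>t. 1 * ?x t + (-1) * ?y t))\<^sup>2" by simp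
    also have "\<dots> = (nrm ?x)\<^sup>2 - 2 * Re (ip ?x ?y) + (nrm ?y)\<^sup>2"
      unfolding nrm_lincomb_square[OF x y] by simp
    also have "\<dots> \<le> 2 * (nrm ?x)\<^sup>2 + 2 * (nrm ?y)\<^sup>2 - 4 * d" using 1 by linarith
    also have "\<dots> \<le> (1/4) ^ n / 2 + (1/4) ^ m / 2" using g(2)[of n] g(2)[of m] by simp
    also have "\<dots> \<le> (1/4) ^ n"
    proof -
      have "(1/4::real) ^ m \<le> (1/4) ^ n" by (rule power_decreasing[OF that]) auto
      then show ?thesis by linarith
    qed
    also have "\<dots> = ((1/2) ^ n)\<^sup>2"
      by (simp add: power2_eq_square flip: power_mult_distrib)
    finally show "(nrm (\<lambda>t. g m t - g n t))\<^sup>2 \<le> ((1/2) ^ n)\<^sup>2" .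
  qed simp
  obtain p where p: "p \<in> V" "\<And>n. nrm (\<lambda>t. p t - g n t) \<le> (1/2) ^ n"
    using complete[of g] g(1) WV cau by blast
  have approx: "\<exists>n. (1/2) ^ n < \<epsilon>" if "\<epsilon> > 0" for \<epsilon> :: real
    using that by (intro real_arch_pow_inv) auto
  define u where "u = (\<lambda>t. f t - p t)"
  have u: "u \<in> V" unfolding u_def by (intro minus_in f p)
  have upper: "nrm u \<le> sqrt d"
  proof (rule field_le_epsilon)
    fix e :: real assume "0 < e"
    then obtain n where n: "(1/2) ^ n < e / 2" using approx[of "e/2"] by auto
    have "nrm u \<le> nrm (\<lambda>t. f t - g n t) + nrm (\<lambda>t. g n t - p t)"
      using nrm_triangle[OF minus_in[OF f WV[OF g(1)]] minus_in[OF WV[OF g(1)] p(1)], of n n]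
      by (simp add: u_def)
    moreover have "nrm (\<lambda>t. g n t - p t) = nrm (\<lambda>t. p t - g n t)"
    proof -
      have "(nrm (\<lambda>t. 0 * p t + (-1) * (\<lambda>t. p t - g n t) t))\<^sup>2 = (nrm (\<lambda>t. p t - g n t))\<^sup>2"
        unfolding nrm_lincomb_square[OF p(1) minus_in[OF p(1) WV[OF g(1)]]] by simp
      then show ?thesis
        using nrm_nonneg minus_in p(1) WV[OF g(1)] by simp
    qed
    moreover have "nrm (\<lambda>t. f t - g n t) \<le> sqrt d + (1/2) ^ n"
    proof (rule power2_le_imp_le)
      have "(nrm (\<lambda>t. f t - g n t))\<^sup>2 \<le> d + (1/4) ^ n"
      proof -
        have "0 \<le> (1/4::real) ^ n" by simp
        then show ?thesis using g(2)[of n] by linarith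
      qed
      also have "(1/4::real) ^ n = ((1/2) ^ n)\<^sup>2"
        by (simp add: power2_eq_square flip: power_mult_distrib)
      also have "d + ((1/2) ^ n)\<^sup>2 \<le> (sqrt d + (1/2) ^ n)\<^sup>2"
        using d0 by (simp add: power2_sum)
      finally show "(nrm (\<lambda>t. f t - g n t))\<^sup>2 \<le> (sqrt d + (1/2) ^ n)\<^sup>2" .
    qed (use d0 in auto)
    ultimately show "nrm u \<le> sqrt d + e" using p(2)[of n] n by linarith
  qed
  \<comment> \<open>As \<open>p\<close> is only a limit of elements of \<open>W\<close>, the infimum
    is compared with \<open>g n\<close> in place of \<open>p\<close>, at the price of an error
    \<open>(1/2) ^ n\<close>.\<close>
  have lower: "sqrt d \<le> nrm (\<lambda>t. u t - a * h t)" if h: "h \<in> W" for a h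
  proof (rule field_le_epsilon)
    fix e :: real assume "0 < e"
    then obtain n where n: "(1/2) ^ n < e" using approx by auto
    have w: "(\<lambda>t. 1 * g n t + a * h t) \<in> W" by (intro Wlin g h)
    have m: "(\<lambda>t. u t - a * h t) \<in> V"
      using lincomb[OF u WV[OF h], of 1 "-a"] by simp
    have "sqrt d \<le> nrm (\<lambda>t. f t - (1 * g n t + a * h t))"
      using dle[OF w] nrm_nonneg[OF minus_in[OF f WV[OF w]]] by (meson real_le_lsqrt)
    also have "\<dots> \<le> nrm (\<lambda>t. u t - a * h t) + nrm (\<lambda>t. p t - g n t)"
      using nrm_triangle[OF m minus_in[OF p(1) WV[OF g(1)]], of n]
      by (simp add: u_def algebra_simps)
    finally show "sqrt d \<le> nrm (\<lambda>t. u t - a * h t) + e" using p(2)[of n] n by linarith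
  qed
  have "ip u h = 0" if "h \<in> W" for h
    by (rule orthogonal_if_minimal[OF u WV[OF that]]) (use upper lower[OF that] in \<open>rule order_trans\<close>)
  moreover have "\<exists>g\<in>W. nrm (\<lambda>t. p t - g t) < \<epsilon>" if "\<epsilon> > 0" for \<epsilon>
    using approx[OF that] p(2) g(1) by (meson le_less_trans)
  ultimately show ?thesis using p(1) unfolding u_def by blast
qed

end

subsection \<open>Hilbert spaces of entire functions\<close>

text \<open>\<open>ev\<close> sends a representative to its entire function. Completeness enters
  through the elements representing evaluation and derivatives. In \<open>divide\<close>, a point of
  \<open>\<Lambda>\<close> has to be a multiple zero because the quotient must vanish there as well.
  Multiplication by \<open>z\<close> need not be defined on all of \<open>V\<close>, hence
  \<open>symmetric\<close> speaks of pairs \<open>f\<close>, \<open>f'\<close> related by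
  it.\<close>

locale entire_hilbert = semi_inner_space V ip
  for V :: "('a \<Rightarrow> complex) set" and ip +
  fixes ev :: "('a \<Rightarrow> complex) \<Rightarrow> complex \<Rightarrow> complex" and \<Lambda> :: "complex set"
  assumes ev_lincomb: "f \<in> V \<Longrightarrow> g \<in> V \<Longrightarrow> ev (\<lambda>t. a * f t + b * g t) z = a * ev f z + b * ev g z"
    and ev_entire: "f \<in> V \<Longrightarrow> ev f holomorphic_on UNIV"
    and ev_zero: "f \<in> V \<Longrightarrow> z \<in> \<Lambda> \<Longrightarrow> ev f z = 0"
    and kernel: "\<exists>k\<in>V. \<forall>f\<in>V. ip f k = ev f z"
    and deriv_kernel: "\<exists>k\<in>V. \<forall>f\<in>V. ip f k = deriv (ev f) z"
    and divide: "f \<in> V \<Longrightarrow> ev f w = 0 \<Longrightarrow> (w \<in> \<Lambda> \<Longrightarrow> deriv (ev f) w = 0) \<Longrightarrow>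
      \<exists>g\<in>V. \<forall>z. ev f z = (z - w) * ev g z"
    and symmetric: "f \<in> V \<Longrightarrow> g \<in> V \<Longrightarrow> f' \<in> V \<Longrightarrow> g' \<in> V \<Longrightarrow>
      (\<And>z. ev f' z = z * ev f z) \<Longrightarrow> (\<And>z. ev g' z = z * ev g z) \<Longrightarrow> ip f' g = ip f g'"
    and nontrivial: "\<exists>f\<in>V. \<exists>z. ev f z \<noteq> 0"
begin

lemma ev_cont: "f \<in> V \<Longrightarrow> continuous_on UNIV (ev f)"
  by (simp add: ev_entire holomorphic_on_imp_continuous_on)

lemma ev_eqI:
  assumes "f \<in> V" "g \<in> V" "\<And>z. (z - w) * ev f z = (z - w) * ev g z"
  shows "ev f z = ev g z"
proof -
  have "ev f z - ev g z = 0"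
    by (rule entire_eq_0I[where a=w and f="\<lambda>z. ev f z - ev g z"])
      (use assms in \<open>auto intro!: holomorphic_on_diff ev_entire\<close>)
  then show ?thesis by simp
qed

lemma ev_eq_0_if_nrm_0:
  assumes "f \<in> V" "nrm f = 0"
  shows "ev f z = 0"
proof -
  obtain k where k: "k \<in> V" "ip f k = ev f z" using kernel assms by blast
  then show ?thesis using ip_Cauchy_Schwarz[OF assms(1) k(1)] assms(2) by simp
qed

text \<open>A relation rather than a function, as the form determines the kernel only up to an
  element of seminorm 0.\<close>

definition reproducing :: "('a \<Rightarrow> complex) \<Rightarrow> complex \<Rightarrow> bool" where
  "reproducing k z \<longleftrightarrow> k \<in> V \<and> (\<forall>f\<in>V. ip f k = ev f z)"

lemma zero_in: "(\<lambda>t. 0) \<in> V"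
  using nontrivial lincomb[of _ _ 0 0] by auto

lemma countable_zeros:
  assumes "f \<in> V" "ev f z \<noteq> 0"
  shows "countable {z. ev f z = 0}"
  using countable_zeros_entire ev_entire assms by blast

section \<open>Zeros of reproducing kernels\<close>

text \<open>The resolvent estimate for the self-adjoint extension of multiplication by \<open>z\<close>
  for which \<open>k\<close>, the kernel at \<open>s\<close>, is an eigenvector; \<open>\<lambda>t. h t - c * k t\<close> is the resolvent
  at \<open>w\<close> applied to \<open>f\<close>.\<close>

lemma resolvent_bound:
  assumes s: "s \<in> \<real>" and k: "reproducing k s" and f: "f \<in> V" and h: "h \<in> V"
    and eq: "\<And>z. (z - w) * ev h z = ev f z - c * (w - s) * ev k z"
  shows "\<bar>Im w\<bar> * nrm (\<lambda>t. h t - c * k t) \<le> nrm f"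
proof -
  have kV: "k \<in> V" and rep: "\<And>f. f \<in> V \<Longrightarrow> ip f k = ev f s"
    using k by (auto simp: reproducing_def)
  define g where "g = (\<lambda>t. 1 * h t + (-c) * k t)"
  define f1 where "f1 = (\<lambda>t. 1 * f t + (- c * (w - s)) * k t)"
  \<comment> \<open>By \<open>eq\<close>, \<open>f1\<close> represents
    \<open>(z - w) * ev h z\<close>; hence \<open>h1\<close> represents
    \<open>z * ev h z\<close>.\<close>
  define h1 where "h1 = (\<lambda>t. 1 * f1 t + w * h t)"
  have V: "g \<in> V" "f1 \<in> V" "h1 \<in> V"
    unfolding g_def h1_def f1_def by (intro lincomb f h kV)+
  have evh1: "ev h1 z = z * ev h z" for z
    using eq[of z] unfolding h1_def f1_def
    by (simp only: ev_lincomb f h kV V[unfolded f1_def]) (simp add: algebra_simps)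
  have f_eq: "f = (\<lambda>t. 1 * (\<lambda>t. 1 * h1 t + (- w) * h t) t + (c * (w - s)) * k t)"
    by (simp add: h1_def f1_def)
  have V2: "(\<lambda>t. 1 * h1 t + (- w) * h t) \<in> V" by (intro lincomb V h)
  have ipf: "ip f u = ip h1 u - w * ip h u + c * (w - s) * ip k u" if "u \<in> V" for u
    using that by (subst f_eq) (simp only: ip_lincomb V V2 h kV, simp)
  have ipg: "ip u g = ip u h - cnj c * ip u k" if "u \<in> V" for u
    using that by (simp only: g_def ip_lincomb_right h kV) simp
  have ipg': "ip g u = ip h u - c * ip k u" if "u \<in> V" for u
    using that by (simp only: g_def ip_lincomb h kV) simp
  have "ip h1 h = ip h h1" by (rule symmetric) (use h V evh1 in auto)
  then have r1: "Im (ip h1 h) = 0"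
    using ip_commute[OF h V(3)] by (auto simp: complex_eq_iff)
  have r2: "ip h1 k = s * ip h k" by (simp add: rep V h evh1)
  have ipkh: "ip k h = cnj (ip h k)" by (rule ip_commute) (use h kV in auto)
  have rs: "Im s = 0" using s by (simp add: complex_is_Real_iff)
  have rk: "Im (ip k k) = 0" "Im (ip h h) = 0" using ip_self kV h by auto
  \<comment> \<open>Symmetry makes \<open>ip h1 h\<close> real, and
    \<open>ip h1 k = s * ip h k\<close> with \<open>s\<close> real, so only the terms with the
    factor \<open>Im w\<close> survive.\<close>
  have "Im (ip f g) = - Im w * Re (ip g g)"
    unfolding ipf[OF V(1)] ipg[OF V(3)] ipg[OF h] ipg[OF kV] ipg[OF V(1)] ipg'[OF h] ipg'[OF kV] r2 ipkh
    using r1 rs rk by (simp add: algebra_simps)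
  then have "\<bar>Im w\<bar> * (nrm g)\<^sup>2 = \<bar>Im (ip f g)\<bar>"
    using ip_self[OF V(1)] by (simp add: abs_mult)
  also have "\<dots> \<le> nrm f * nrm g"
    using ip_Cauchy_Schwarz[OF f V(1)] abs_Im_le_cmod order_trans by blast
  finally have "nrm g * (\<bar>Im w\<bar> * nrm g) \<le> nrm g * nrm f"
    by (simp add: power2_eq_square algebra_simps)
  then have "\<bar>Im w\<bar> * nrm g \<le> nrm f"
    using nrm_nonneg[OF V(1)] nrm_nonneg[OF f]
    by (cases "nrm g = 0") (auto simp: mult_le_cancel_left)
  then show ?thesis by (simp add: g_def)
qed

text \<open>Suppose that \<open>k\<close> could be divided by \<open>z - w\<close>, with quotient
  \<open>p\<close>. The resolvent bound for \<open>f = 0\<close> and \<open>c = 1\<close> then shows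
  that \<open>(s - w) * p\<close> and \<open>k\<close> have the same entire function. So
  \<open>(z - s) * ev p z = 0\<close>, and \<open>k\<close> would vanish even at
  \<open>s\<close>.\<close>

lemma kernel_zero_nonreal:
  assumes s: "s \<in> \<real>" and k: "reproducing k s" and nz: "ev k s \<noteq> 0"
    and w: "w \<notin> \<real>" "ev k w = 0"
  shows "w \<in> \<Lambda>" "deriv (ev k) w \<noteq> 0"
proof -
  have kV: "k \<in> V" using k by (auto simp: reproducing_def)
  have "w \<in> \<Lambda> \<and> deriv (ev k) w \<noteq> 0"
  proof (rule ccontr)
    assume "\<not> ?thesis"
    then obtain p where p: "p \<in> V" "\<And>z. ev k z = (z - w) * ev p z"
      using divide[OF kV w(2)] by blast
    define h where "h = (\<lambda>t. (s - w) * p t + 0 * p t)"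
    have h: "h \<in> V" unfolding h_def by (intro lincomb p)
    have evh: "ev h z = (s - w) * ev p z" for z
      unfolding h_def by (simp only: ev_lincomb p) simp
    have "\<bar>Im w\<bar> * nrm (\<lambda>t. h t - 1 * k t) \<le> nrm (\<lambda>t. 0 * k t + 0 * k t)"
      by (rule resolvent_bound[OF s k lincomb[OF kV kV] h])
        (simp only: ev_lincomb kV p(2) evh, simp add: algebra_simps)
    also have "\<dots> = 0"
      using ip_lincomb[OF kV kV zero_in, of 0 0] by (simp add: nrm_def)
    finally have "nrm (\<lambda>t. 1 * h t + (-1) * k t) \<le> 0"
      using w(1) by (simp add: complex_is_Real_iff mult_le_0_iff)
    then have "ev (\<lambda>t. 1 * h t + (-1) * k t) z = 0" for z
      by (intro ev_eq_0_if_nrm_0 lincomb h kV antisym nrm_nonneg)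
    then have *: "ev h z = ev k z" for z
      by (simp only: ev_lincomb h kV) simp
    have "ev k s = ev (\<lambda>t. 0 * k t + 0 * k t) s"
    proof (rule ev_eqI[OF kV lincomb[OF kV kV], of s])
      fix z
      have "(z - w) * ev p z = (s - w) * ev p z"
        unfolding p(2)[symmetric] evh[symmetric] by (rule *[symmetric])
      then have "z = s \<or> ev p z = 0" by auto
      then have "(z - s) * ev p z = 0" by auto
      then have "(z - s) * ev k z = 0" using p(2)[of z] by auto
      then show "(z - s) * ev k z = (z - s) * ev (\<lambda>t. 0 * k t + 0 * k t) z"
        by (simp only: ev_lincomb kV) simp
    qed
    also have "\<dots> = 0" by (simp only: ev_lincomb kV) simp
    finally show False using nz by simp
  qed
  then show "w \<in> \<Lambda>" "deriv (ev k) w \<noteq> 0" by auto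
qed

lemma deriv_times:
  assumes "f \<in> V" shows "deriv (\<lambda>z. (z - s) * ev f z) w = ev f w + (w - s) * deriv (ev f) w"
proof (rule DERIV_imp_deriv)
  have "(ev f has_field_derivative deriv (ev f) w) (at w)"
    using ev_entire[OF assms] by (simp add: holomorphic_derivI)
  then show "((\<lambda>z. (z - s) * ev f z) has_field_derivative ev f w + (w - s) * deriv (ev f) w) (at w)"
    by (auto intro!: derivative_eq_intros)
qed

text \<open>At a double zero put \<open>p = k / (z - w)\<close>, \<open>q = (z - s) * p\<close> and
  \<open>r = q / (z - w)\<close>. Symmetry gives \<open>ip q p = ip r k = ev r s\<close>, whence
  \<open>ip q q = ev q s + (w - s) * ev r s = 0\<close>. So the functions of \<open>q\<close>, of
  \<open>p\<close> and finally of \<open>k\<close> vanish.\<close>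

lemma kernel_zero_real:
  assumes s: "s \<in> \<real>" and k: "reproducing k s" and nz: "ev k s \<noteq> 0"
    and w: "w \<in> \<real>" "w \<notin> \<Lambda>" "ev k w = 0"
  shows "deriv (ev k) w \<noteq> 0"
proof -
  have kV: "k \<in> V" and rep: "\<And>f. f \<in> V \<Longrightarrow> ip f k = ev f s"
    using k by (auto simp: reproducing_def)
  obtain p where p: "p \<in> V" "\<And>z. ev k z = (z - w) * ev p z"
    using divide[OF kV w(3)] w(2) by blast
  have dk: "deriv (ev k) w = ev p w"
    using deriv_times[OF p(1), of w w] by (simp flip: p(2))
  have "ev p w \<noteq> 0"
  proof
    assume p0: "ev p w = 0"
    \<comment> \<open>Written as \<open>(z - w) * p + (w - s) * p\<close>, the product
      \<open>(z - s) * p\<close> is seen to lie in \<open>V\<close>.\<close>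
    define q where "q = (\<lambda>t. 1 * k t + (w - s) * p t)"
    have q: "q \<in> V" unfolding q_def by (intro lincomb kV p)
    have evq: "ev q z = (z - s) * ev p z" for z
      unfolding q_def by (simp only: ev_lincomb kV p) (simp add: algebra_simps)
    obtain r where r: "r \<in> V" "\<And>z. ev q z = (z - w) * ev r z"
      using divide[OF q, of w] w(2) p0 evq by auto
    define p1 where "p1 = (\<lambda>t. 1 * k t + w * p t)"
    define r1 where "r1 = (\<lambda>t. 1 * q t + w * r t)"
    have V: "p1 \<in> V" "r1 \<in> V" unfolding p1_def r1_def by (intro lincomb kV p q r)+
    have "ip r1 p = ip r p1"
    proof (rule symmetric[OF r(1) p(1) V(2) V(1)])
      show "ev r1 z = z * ev r z" for z
        unfolding r1_def by (simp only: ev_lincomb q r(1)) (simp add: r algebra_simps)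
      show "ev p1 z = z * ev p z" for z
        unfolding p1_def by (simp only: ev_lincomb kV p(1)) (simp add: p algebra_simps)
    qed
    moreover have "ip r1 p = ip q p + w * ip r p"
      unfolding r1_def by (simp only: ip_lincomb q r p) simp
    moreover have "cnj w = w" using w(1) by (simp add: Reals_cnj_iff)
    then have "ip r p1 = ip r k + w * ip r p"
      unfolding p1_def by (simp only: ip_lincomb_right kV r p) simp
    ultimately have "ip q p = ev r s" by (simp add: rep r)
    moreover have "cnj (w - s) = w - s" using w(1) s by (simp add: Reals_cnj_iff)
    then have "ip q q = ip q k + (w - s) * ip q p"
      by (subst (2) q_def) (simp only: ip_lincomb_right kV q p, simp)
    ultimately have "ip q q = 0" using r(2)[of s] by (simp add: rep q algebra_simps)
    then have "ev q z = 0" for z by (intro ev_eq_0_if_nrm_0 q) (simp add: nrm_def)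
    then have "ev p z = 0" if "z \<noteq> s" for z using that evq[of z] by simp
    then have "(z - s) * ev p z = (z - s) * ev (\<lambda>t. 0 * k t + 0 * k t) z" for z
      by (cases "z = s") (simp_all only: ev_lincomb kV, simp_all)
    then have "ev p s = ev (\<lambda>t. 0 * k t + 0 * k t) s"
      using ev_eqI[OF p(1) lincomb[OF kV kV], of s] by blast
    also have "\<dots> = 0" by (simp only: ev_lincomb kV) simp
    finally show False using p(2) nz by simp
  qed
  then show ?thesis using dk by simp
qed

section \<open>Regular points\<close>

text \<open>Otherwise all elements have a multiple zero at \<open>w\<close>, so
  \<open>divide\<close> can be repeated and removes arbitrarily high powers of \<open>z - w\<close>
  from a nonzero function. This contradicts the finite order of its zero.\<close>

lemma deriv_nontrivial:
  assumes w: "w \<in> \<Lambda>"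
  shows "\<exists>f\<in>V. deriv (ev f) w \<noteq> 0"
proof (rule ccontr)
  assume "\<not> ?thesis"
  then have dz: "deriv (ev f) w = 0" if "f \<in> V" for f using that by blast
  obtain f0 z0 where f0: "f0 \<in> V" "ev f0 z0 \<noteq> 0" using nontrivial by blast
  have power: "\<exists>g\<in>V. \<forall>z. ev f0 z = (z - w) ^ n * ev g z" for n
  proof (induction n)
    case 0
    then show ?case using f0 by auto
  next
    case (Suc n)
    then obtain g where g: "g \<in> V" "\<And>z. ev f0 z = (z - w) ^ n * ev g z" by blast
    obtain g' where "g' \<in> V" "\<And>z. ev g z = (z - w) * ev g' z"
      using divide[OF g(1) ev_zero[OF g(1) w] dz[OF g(1)]] by blast
    then show ?case using g(2) by (intro bexI[of _ g']) auto
  qed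
  have "\<not> ev f0 constant_on UNIV"
    using ev_zero[OF f0(1) w] f0(2) by (metis UNIV_I constant_on_def)
  then obtain g r n where g: "0 < r" "g holomorphic_on ball w r"
      "\<And>z. z \<in> ball w r \<Longrightarrow> ev f0 z = (z - w) ^ n * g z"
      "\<And>z. z \<in> ball w r \<Longrightarrow> g z \<noteq> 0"
    using holomorphic_factor_zero_nonconstant[OF ev_entire[OF f0(1)] open_UNIV connected_UNIV
        UNIV_I ev_zero[OF f0(1) w]] by (metis (no_types, lifting))
  \<comment> \<open>One power more than the order \<open>n\<close> of the zero forces
    \<open>g w = 0\<close>.\<close>
  obtain p where p: "p \<in> V" "\<And>z. ev f0 z = (z - w) ^ Suc n * ev p z"
    using power by blast
  have "isCont g w" "isCont (ev p) w"
    using g(1,2) ev_cont[OF p(1)] holomorphic_on_imp_continuous_on[OF g(2)]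
    by (auto simp: continuous_on_eq_continuous_at)
  then have "(\<lambda>z. g z - (z - w) * ev p z) \<midarrow>w\<rightarrow> g w - (w - w) * ev p w"
    by (intro tendsto_intros) (auto simp: isCont_def)
  moreover have "eventually (\<lambda>z. g z - (z - w) * ev p z = 0) (at w)"
  proof -
    have "eventually (\<lambda>z. z \<in> ball w r) (at w)"
      using g(1) by (intro eventually_at_in_open') auto
    moreover have "eventually (\<lambda>z. z \<noteq> w) (at w)"
      by (simp add: eventually_at_filter)
    ultimately show ?thesis
    proof eventually_elim
      case (elim z)
      then have "(z - w) ^ n * g z = (z - w) ^ n * ((z - w) * ev p z)"
        using g(3)[of z] p(2)[of z] by simp
      then show ?case using elim by simp
    qed
  qed
  ultimately have "((\<lambda>z. 0) \<longlongrightarrow> g w) (at w)"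
    using Lim_transform_eventually by fastforce
  then have "g w = 0" by (simp add: tendsto_const_iff)
  then show False using g(1,4) by simp
qed

text \<open>Designed so that \<open>(z - s) * ev k z\<close> has only simple zeros: some nonzero
  \<open>ev f s\<close> ensures \<open>ev k s \<noteq> 0\<close>, and the last condition excludes
  multiple zeros of the kernel in \<open>\<Lambda>\<close>. Real zeros outside of
  \<open>\<Lambda>\<close> are simple by \<open>kernel_zero_real\<close>.\<close>

definition regular_point :: "complex \<Rightarrow> bool" where
  "regular_point s \<longleftrightarrow> s \<in> \<real> \<and> (\<exists>f\<in>V. ev f s \<noteq> 0) \<and>
     (\<forall>k. \<forall>l\<in>\<Lambda>. reproducing k s \<longrightarrow> deriv (ev k) l \<noteq> 0)"

text \<open>If \<open>L l\<close> represents the derivative at \<open>l\<close>, then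
  \<open>deriv (ev k) l = cnj (ev (L l) s)\<close> for the kernel \<open>k\<close> at
  \<open>s\<close>. The exceptional points thus lie among the zeros of countably many nonzero entire
  functions.\<close>

lemma countable_not_regular: "countable {s\<in>\<real>. \<not> regular_point s}"
proof -
  obtain f0 z0 where f0: "f0 \<in> V" "ev f0 z0 \<noteq> 0" using nontrivial by blast
  have c0: "countable {z. ev f0 z = 0}" using countable_zeros f0 by blast
  have "\<Lambda> \<subseteq> {z. ev f0 z = 0}" using ev_zero f0 by auto
  then have cL: "countable \<Lambda>" using c0 countable_subset by blast
  have "\<exists>L. \<forall>l. L l \<in> V \<and> (\<forall>f\<in>V. ip f (L l) = deriv (ev f) l)"
    using deriv_kernel by metis
  then obtain L where L: "\<And>l. L l \<in> V" "\<And>l f. f \<in> V \<Longrightarrow> ip f (L l) = deriv (ev f) l"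
    by blast
  have "countable {s. ev (L l) s = 0}" if l: "l \<in> \<Lambda>" for l
  proof -
    have "\<exists>z. ev (L l) z \<noteq> 0"
    proof (rule ccontr)
      assume "\<not> ?thesis"
      then have "ev (L l) = (\<lambda>z. 0)" by auto
      then have "ip (L l) (L l) = 0" using L by simp
      then have "nrm (L l) = 0" by (simp add: nrm_def)
      moreover obtain f where "f \<in> V" "deriv (ev f) l \<noteq> 0" using deriv_nontrivial[OF l] by blast
      ultimately show False using ip_Cauchy_Schwarz[of f "L l"] L by simp
    qed
    then show ?thesis using countable_zeros L(1) by blast
  qed
  then have "countable ({z. ev f0 z = 0} \<union> (\<Union>l\<in>\<Lambda>. {s. ev (L l) s = 0}))"
    using c0 cL by auto
  moreover have "{s\<in>\<real>. \<not> regular_point s} \<subseteq> {z. ev f0 z = 0} \<union> (\<Union>l\<in>\<Lambda>. {s. ev (L l) s = 0})"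
  proof
    fix s assume s: "s \<in> {s\<in>\<real>. \<not> regular_point s}"
    show "s \<in> {z. ev f0 z = 0} \<union> (\<Union>l\<in>\<Lambda>. {s. ev (L l) s = 0})"
    proof (rule ccontr)
      assume n: "\<not> ?thesis"
      have "regular_point s"
        unfolding regular_point_def
      proof (intro conjI allI ballI impI)
        show "s \<in> \<real>" using s by simp
        show "\<exists>f\<in>V. ev f s \<noteq> 0" using n f0(1) by auto
        fix k l assume l: "l \<in> \<Lambda>" and k: "reproducing k s"
        have "deriv (ev k) l = cnj (ip (L l) k)"
          using k L ip_commute[of "L l" k] by (simp add: reproducing_def)
        also have "\<dots> = cnj (ev (L l) s)" using k L(1) by (simp add: reproducing_def)
        also have "\<dots> \<noteq> 0" using n l by auto
        finally show "deriv (ev k) l \<noteq> 0" .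
      qed
      then show False using s by simp
    qed
  qed
  ultimately show ?thesis using countable_subset by blast
qed

text \<open>\<open>ev k s\<close> is the square norm of \<open>k\<close>; were it 0, all values
  \<open>ev f s = ip f k\<close> would vanish.\<close>

lemma regular_kernel_nonzero:
  assumes "regular_point s" "reproducing k s"
  shows "ev k s \<noteq> 0"
proof
  assume "ev k s = 0"
  then have "nrm k = 0" using assms(2) by (simp add: reproducing_def nrm_def)
  moreover obtain f where "f \<in> V" "ev f s \<noteq> 0" using assms(1) by (auto simp: regular_point_def)
  ultimately show False
    using ip_Cauchy_Schwarz[of f k] assms(2) by (simp add: reproducing_def)
qed

text \<open>The derivative is \<open>ev k s\<close> at \<open>s\<close> and
  \<open>(w - s) * deriv (ev k) w\<close> at any other zero \<open>w\<close>, so the results on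
  zeros of the kernel apply.\<close>

lemma regular_zeros:
  assumes s: "regular_point s" and k: "reproducing k s" and w: "(w - s) * ev k w = 0"
  shows "deriv (\<lambda>z. (z - s) * ev k z) w \<noteq> 0" "w \<notin> \<Lambda> \<Longrightarrow> w \<in> \<real>"
proof -
  have kV: "k \<in> V" using k by (simp add: reproducing_def)
  have sr: "s \<in> \<real>" using s by (simp add: regular_point_def)
  note nz = regular_kernel_nonzero[OF s k]
  have *: "deriv (ev k) w \<noteq> 0" "w \<notin> \<Lambda> \<Longrightarrow> w \<in> \<real>" if "w \<noteq> s"
  proof -
    have 0: "ev k w = 0" using w that by simp
    show "w \<notin> \<Lambda> \<Longrightarrow> w \<in> \<real>" using kernel_zero_nonreal(1)[OF sr k nz _ 0] by blast
    show "deriv (ev k) w \<noteq> 0"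
      using kernel_zero_nonreal(2)[OF sr k nz _ 0] kernel_zero_real[OF sr k nz _ _ 0] s k
      by (auto simp: regular_point_def)
  qed
  show "deriv (\<lambda>z. (z - s) * ev k z) w \<noteq> 0"
    using * nz w by (cases "w = s") (auto simp: deriv_times[OF kV])
  show "w \<notin> \<Lambda> \<Longrightarrow> w \<in> \<real>" using * sr by (cases "w = s") auto
qed

section \<open>The generating function and its zero set\<close>

text \<open>As the zeros of \<open>\<Phi>\<close> are simple, \<open>h = f / \<Phi>\<close> is
  entire. The resolvent bound, evaluated at one fixed point \<open>z0\<close>, becomes the growth
  bound of \<open>entire_constantI\<close> for \<open>h\<close>.\<close>

lemma multiple_of_generating:
  assumes s: "regular_point s" and k: "reproducing k s" and f: "f \<in> V"
    and zeros: "\<And>w. w \<in> \<real> - \<Lambda> \<Longrightarrow> (w - s) * ev k w = 0 \<Longrightarrow> ev f w = 0"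
  shows "\<exists>c. \<forall>z. ev f z = c * ((z - s) * ev k z)"
proof -
  define \<Phi> where "\<Phi> = (\<lambda>z. (z - s) * ev k z)"
  have kV: "k \<in> V" using k by (simp add: reproducing_def)
  have sr: "s \<in> \<real>" using s by (simp add: regular_point_def)
  note nz = regular_kernel_nonzero[OF s k]
  have zf: "ev f z = 0 \<and> deriv \<Phi> z \<noteq> 0" if "\<Phi> z = 0" for z
  proof
    have 0: "(z - s) * ev k z = 0" using that by (simp add: \<Phi>_def)
    show "deriv \<Phi> z \<noteq> 0" unfolding \<Phi>_def by (rule regular_zeros(1)[OF s k 0])
    show "ev f z = 0"
    proof (cases "z \<in> \<Lambda>")
      case False
      then show ?thesis using zeros[OF _ 0] regular_zeros(2)[OF s k 0] by simp
    qed (rule ev_zero[OF f])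
  qed
  have hol: "\<Phi> holomorphic_on UNIV"
    unfolding \<Phi>_def by (intro holomorphic_intros ev_entire kV)
  obtain h where h: "h holomorphic_on UNIV" "\<And>z. ev f z = h z * \<Phi> z"
    by (rule entire_quotient_simple_zeros[OF ev_entire[OF f] hol]) (auto dest: zf intro: that)
  obtain z0 where z0: "\<Phi> z0 \<noteq> 0"
  proof -
    have "\<exists>z. \<Phi> z \<noteq> 0"
    proof (rule ccontr)
      assume "\<not> ?thesis"
      then have "\<Phi> = (\<lambda>z. 0)" by auto
      then show False using zf[of 0] by simp
    qed
    then show ?thesis using that by blast
  qed
  obtain k0 where k0: "k0 \<in> V" "\<And>f. f \<in> V \<Longrightarrow> ip f k0 = ev f z0" using kernel by blast
  define A where "A = nrm f * nrm k0 / cmod (\<Phi> z0)"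
  have A: "0 \<le> A" unfolding A_def using nrm_nonneg f k0 by auto
  have "\<bar>Im w\<bar> * cmod (h w - h z0) \<le> (A * (1 + cmod z0)) * (1 + cmod w)" for w
  proof (cases "w \<in> \<real>")
    case True
    then show ?thesis using A by (simp add: complex_is_Real_iff)
  next
    case False
    \<comment> \<open>This constant makes \<open>f - c * (w - s) * k\<close> vanish at
      \<open>w\<close>, since \<open>ev f w = h w * \<Phi> w\<close>.\<close>
    define c where "c = h w"
    define n where "n = (\<lambda>t. 1 * f t + (- (c * (w - s))) * k t)"
    have n: "n \<in> V" unfolding n_def by (intro lincomb f kV)
    have evn: "ev n = (\<lambda>z. ev f z - c * (w - s) * ev k z)"
      by (rule ext) (simp only: n_def ev_lincomb f kV, simp)
    have "\<exists>g\<in>V. \<forall>z. ev n z = (z - w) * ev g z"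
    proof (rule divide[OF n])
      show "ev n w = 0" by (simp add: evn h(2) \<Phi>_def c_def)
      \<comment> \<open>At a point of \<open>\<Lambda>\<close> the derivative must vanish as well.
        As \<open>\<Phi>\<close> and \<open>ev k\<close> vanish at \<open>w\<close>, the product
        rule reduces to \<open>deriv (ev f) w = h w * (w - s) * deriv (ev k) w\<close>.\<close>
      assume w: "w \<in> \<Lambda>"
      have "w \<noteq> s" using False sr by auto
      have kw: "ev k w = 0" using ev_zero[OF kV w] .
      have d: "(ev u has_field_derivative deriv (ev u) w) (at w)" if "u \<in> V" for u
        using ev_entire[OF that] by (simp add: holomorphic_derivI)
      have "(\<Phi> has_field_derivative deriv \<Phi> w) (at w)" "(h has_field_derivative deriv h w) (at w)"
        using hol h(1) by (simp_all add: holomorphic_derivI)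
      then have "((\<lambda>z. h z * \<Phi> z) has_field_derivative deriv h w * \<Phi> w + deriv \<Phi> w * h w) (at w)"
        by (rule DERIV_mult[rotated])
      then have "(ev f has_field_derivative deriv h w * \<Phi> w + deriv \<Phi> w * h w) (at w)"
        unfolding h(2)[symmetric] .
      then have "deriv (ev f) w = deriv h w * \<Phi> w + deriv \<Phi> w * h w"
        by (rule DERIV_imp_deriv)
      then have "deriv (ev f) w = h w * deriv \<Phi> w"
        using kw by (simp add: \<Phi>_def)
      also have "deriv \<Phi> w = (w - s) * deriv (ev k) w"
        unfolding \<Phi>_def deriv_times[OF kV] kw by simp
      finally have df: "deriv (ev f) w = c * (w - s) * deriv (ev k) w" by (simp add: c_def)
      have "((\<lambda>z. ev f z - c * (w - s) * ev k z) has_field_derivative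
          deriv (ev f) w - c * (w - s) * deriv (ev k) w) (at w)"
        by (intro DERIV_diff DERIV_cmult d f kV)
      then show "deriv (ev n) w = 0"
        unfolding evn using df by (simp add: DERIV_imp_deriv)
    qed
    then obtain g where g: "g \<in> V" "\<And>z. ev n z = (z - w) * ev g z" by blast
    have bound: "\<bar>Im w\<bar> * nrm (\<lambda>t. g t - c * k t) \<le> nrm f"
      by (rule resolvent_bound[OF sr k f g(1)]) (simp add: evn flip: g(2))
    define r where "r = (\<lambda>t. 1 * g t + (-c) * k t)"
    have r: "r \<in> V" unfolding r_def by (intro lincomb g kV)
    have "ev r z0 = ev g z0 - c * ev k z0"
      unfolding r_def by (simp only: ev_lincomb g(1) kV) simp
    then have "(z0 - w) * ev r z0 = (z0 - w) * ev g z0 - (z0 - w) * (c * ev k z0)"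
      by (simp only: right_diff_distrib)
    also have "\<dots> = ev f z0 - c * \<Phi> z0"
      unfolding g(2)[symmetric] by (simp add: evn \<Phi>_def algebra_simps)
    also have "\<dots> = (h z0 - h w) * \<Phi> z0" by (simp add: h(2) c_def algebra_simps)
    finally have eq: "(h z0 - h w) * \<Phi> z0 = (z0 - w) * ev r z0" by simp
    have "cmod (h w - h z0) * cmod (\<Phi> z0) = cmod (z0 - w) * cmod (ev r z0)"
      using arg_cong[OF eq, of cmod] by (simp add: norm_mult norm_minus_commute)
    also have "\<dots> \<le> cmod (z0 - w) * (nrm r * nrm k0)"
      using ip_Cauchy_Schwarz[OF r k0(1)] k0(2)[OF r] by (intro mult_left_mono) auto
    finally have "\<bar>Im w\<bar> * (cmod (h w - h z0) * cmod (\<Phi> z0)) \<le>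
        \<bar>Im w\<bar> * (cmod (z0 - w) * (nrm r * nrm k0))"
      by (intro mult_left_mono) auto
    also have "\<dots> = (\<bar>Im w\<bar> * nrm r) * (cmod (z0 - w) * nrm k0)" by simp
    also have "\<dots> \<le> nrm f * (cmod (z0 - w) * nrm k0)"
      using bound nrm_nonneg[OF k0(1)] by (intro mult_right_mono) (auto simp: r_def)
    finally have "(\<bar>Im w\<bar> * cmod (h w - h z0)) * cmod (\<Phi> z0) \<le> (A * cmod (z0 - w)) * cmod (\<Phi> z0)"
      using z0 by (simp add: A_def mult_ac)
    then have "\<bar>Im w\<bar> * cmod (h w - h z0) \<le> A * cmod (z0 - w)"
      using z0 by (simp add: mult_le_cancel_right)
    also have "\<dots> \<le> A * ((1 + cmod z0) * (1 + cmod w))"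
    proof (intro mult_left_mono A)
      have "cmod (z0 - w) \<le> cmod z0 + cmod w" by (rule norm_triangle_ineq4)
      also have "\<dots> \<le> (1 + cmod z0) * (1 + cmod w)" by (simp add: algebra_simps)
      finally show "cmod (z0 - w) \<le> (1 + cmod z0) * (1 + cmod w)" .
    qed
    finally show ?thesis by (simp add: mult.assoc)
  qed
  then have "h constant_on UNIV" by (rule entire_constantI[OF h(1)])
  then obtain c where "\<And>z. h z = c" by (auto simp: constant_on_def)
  then show ?thesis using h(2) by (auto simp: \<Phi>_def)
qed

text \<open>In de Branges' terms, at most one phase is exceptional.\<close>

lemma exists_regular_generating:
  "\<exists>s k. regular_point s \<and> reproducing k s \<and> \<not> (\<exists>f\<in>V. \<forall>z. ev f z = (z - s) * ev k z)"
proof (rule ccontr)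
  assume "\<not> ?thesis"
  then have ex: "\<exists>f\<in>V. \<forall>z. ev f z = (z - s) * ev k z" if "regular_point s" "reproducing k s" for s k
    using that by blast
  have unc: "uncountable (\<real> :: complex set)"
    unfolding Reals_def using uncountable_UNIV_real
    by (metis countable_image_inj_on inj_of_real)
  have "\<exists>s. regular_point s"
    using countable_not_regular unc by (metis (mono_tags, lifting) Collect_mem_eq Collect_mono countable_subset)
  then obtain s where s: "regular_point s" by blast
  obtain k where k: "reproducing k s" using kernel by (auto simp: reproducing_def)
  note nz = regular_kernel_nonzero[OF s k]
  have kV: "k \<in> V" using k by (simp add: reproducing_def)
  obtain p where p: "p \<in> V" "\<And>z. ev p z = (z - s) * ev k z" using ex[OF s k] by blast
  have "countable (insert s ({s\<in>\<real>. \<not> regular_point s} \<union> {z. ev k z = 0}))"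
    using countable_not_regular countable_zeros[OF kV nz] by simp
  \<comment> \<open>At a second regular point \<open>s'\<close> with
    \<open>ev k s' \<noteq> 0\<close>, symmetry will force \<open>ev p' s = 0\<close>, whereas
    \<open>ev p' s = (s - s') * cnj (ev k s')\<close> is nonzero.\<close>
  then have "\<exists>s'\<in>\<real>. s' \<notin> insert s ({s\<in>\<real>. \<not> regular_point s} \<union> {z. ev k z = 0})"
    using unc by (meson countable_subset subsetI)
  then obtain s' where s': "regular_point s'" "ev k s' \<noteq> 0" "s' \<noteq> s" by blast
  obtain k' where k': "reproducing k' s'" using kernel by (auto simp: reproducing_def)
  have kV': "k' \<in> V" using k' by (simp add: reproducing_def)
  obtain p' where p': "p' \<in> V" "\<And>z. ev p' z = (z - s') * ev k' z" using ex[OF s'(1) k'] by blast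
  have rep: "ip f k = ev f s" "ip f k' = ev f s'" if "f \<in> V" for f
    using that k k' by (auto simp: reproducing_def)
  \<comment> \<open>\<open>q\<close> and \<open>q'\<close> represent the products of
    \<open>z\<close> with \<open>ev k\<close> and \<open>ev k'\<close>.\<close>
  define q where "q = (\<lambda>t. 1 * p t + s * k t)"
  define q' where "q' = (\<lambda>t. 1 * p' t + s' * k' t)"
  have q: "q \<in> V" "q' \<in> V" unfolding q_def q'_def by (intro lincomb p p' kV kV')+
  have "ip q k' = ip k q'"
  proof (rule symmetric[OF kV kV' q])
    show "ev q z = z * ev k z" for z
      unfolding q_def by (simp only: ev_lincomb p(1) kV) (simp add: p algebra_simps)
    show "ev q' z = z * ev k' z" for z
      unfolding q'_def by (simp only: ev_lincomb p'(1) kV') (simp add: p' algebra_simps)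
  qed
  moreover have "ip q k' = ev p s' + s * ev k s'"
    using rep(2)[OF q(1)] unfolding q_def by (simp only: ev_lincomb p(1) kV) simp
  moreover have "cnj s' = s'" using s'(1) by (simp add: regular_point_def Reals_cnj_iff)
  then have "ip k q' = ip k p' + s' * ev k s'"
    unfolding q'_def by (simp only: ip_lincomb_right p'(1) kV kV' rep) simp
  ultimately have "ip k p' = 0" by (simp add: p algebra_simps)
  then have "ev p' s = 0" using ip_commute[OF kV p'(1)] rep(1)[OF p'(1)] by simp
  moreover have "ev k' s = cnj (ev k s')"
    using rep(1)[OF kV'] rep(2)[OF kV] ip_commute[OF kV kV'] by simp
  ultimately show False using p'(2) s'(2,3) by auto
qed

text \<open>\<open>S\<close> is the set of zeros outside of \<open>\<Lambda>\<close> of a generating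
  function that is not the transform of any element of \<open>V\<close>. An element vanishing on
  \<open>S\<close> is a multiple of it, necessarily by 0. Dividing it by \<open>z - w\<close> gives
  the dual functions. The point \<open>s\<close> lies in \<open>S\<close>; a point of
  \<open>S\<close> is what the exchange of zeros for minimality starts from.\<close>

theorem exists_real_uniqueness_set:
  obtains S where "S \<subseteq> \<real>" "countable S" "\<Lambda> \<inter> S = {}"
    "\<And>f z. f \<in> V \<Longrightarrow> \<forall>s\<in>S. ev f s = 0 \<Longrightarrow> ev f z = 0"
    "\<And>s. s \<in> S \<Longrightarrow> \<exists>f\<in>V. ev f s \<noteq> 0 \<and> (\<forall>s'\<in>S-{s}. ev f s' = 0)"
    "S \<noteq> {}"
proof -
  obtain s k where s: "regular_point s" and k: "reproducing k s"
    and ex: "\<not> (\<exists>f\<in>V. \<forall>z. ev f z = (z - s) * ev k z)"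
    using exists_regular_generating by blast
  have kV: "k \<in> V" using k by (simp add: reproducing_def)
  have sr: "s \<in> \<real>" using s by (simp add: regular_point_def)
  note nz = regular_kernel_nonzero[OF s k]
  define S where "S = {w \<in> \<real> - \<Lambda>. (w - s) * ev k w = 0}"
  show ?thesis
  proof
    show "S \<subseteq> \<real>" "\<Lambda> \<inter> S = {}" by (auto simp: S_def)
    have "S \<subseteq> insert s {z. ev k z = 0}" by (auto simp: S_def)
    moreover have "countable (insert s {z. ev k z = 0})" using countable_zeros[OF kV nz] by simp
    ultimately show "countable S" by (rule countable_subset)
    have "s \<notin> \<Lambda>" using ev_zero[OF kV] nz by blast
    then show "S \<noteq> {}" using sr by (auto simp: S_def)
  next
    fix f z assume f: "f \<in> V" "\<forall>s\<in>S. ev f s = 0"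
    obtain c where c: "\<And>z. ev f z = c * ((z - s) * ev k z)"
      using multiple_of_generating[OF s k f(1)] f(2) by (auto simp: S_def)
    have "c = 0"
    proof (rule ccontr)
      assume "c \<noteq> 0"
      have "ev (\<lambda>t. inverse c * f t + 0 * f t) z = (z - s) * ev k z" for z
        using \<open>c \<noteq> 0\<close> by (simp only: ev_lincomb f) (simp add: c)
      then show False using ex lincomb[OF f(1) f(1)] by blast
    qed
    then show "ev f z = 0" using c by simp
  next
    fix w assume w: "w \<in> S"
    then have w': "w \<notin> \<Lambda>" "(w - s) * ev k w = 0" by (auto simp: S_def)
    have "\<exists>q\<in>V. \<forall>z. (z - s) * ev k z = (z - w) * ev q z"
    proof (cases "w = s")
      case False
      then obtain p where p: "p \<in> V" "\<And>z. ev k z = (z - w) * ev p z"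
        using divide[OF kV, of w] w' by auto
      define q where "q = (\<lambda>t. 1 * k t + (w - s) * p t)"
      have "q \<in> V" unfolding q_def by (intro lincomb kV p)
      moreover have "ev q z = (z - s) * ev p z" for z
        unfolding q_def by (simp only: ev_lincomb kV p(1)) (simp add: p(2) algebra_simps)
      then have "(z - s) * ev k z = (z - w) * ev q z" for z by (simp add: p(2))
      ultimately show ?thesis by blast
    qed (use kV in auto)
    then obtain q where q: "q \<in> V" "\<And>z. (z - s) * ev k z = (z - w) * ev q z" by blast
    have "deriv (\<lambda>z. (z - s) * ev k z) w = ev q w"
      using deriv_times[OF q(1), of w w] by (simp add: q(2))
    then have "ev q w \<noteq> 0" using regular_zeros(1)[OF s k w'(2)] by simp
    moreover have "ev q w' = 0" if "w' \<in> S - {w}" for w'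
      using that q(2)[of w'] by (auto simp: S_def)
    ultimately show "\<exists>f\<in>V. ev f w \<noteq> 0 \<and> (\<forall>s'\<in>S-{w}. ev f s' = 0)"
      using q(1) by blast
  qed
qed

end

subsection \<open>The space of square-integrable functions\<close>

definition L2_ip :: "'a measure \<Rightarrow> ('a \<Rightarrow> complex) \<Rightarrow> ('a \<Rightarrow> complex) \<Rightarrow> complex" where
  "L2_ip M f g = (LINT t|M. f t * cnj (g t))"

lemma borel_measurable_cnj [measurable]:
  "f \<in> borel_measurable M \<Longrightarrow> (\<lambda>t. cnj (f t)) \<in> borel_measurable M"
  by (erule measurable_compose, rule borel_measurable_continuous_onI)
    (intro continuous_on_cnj continuous_on_id)

lemma L2_measurable: "f \<in> L2_space M \<Longrightarrow> f \<in> borel_measurable M"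
  by (simp add: L2_space_def)

lemma L2_mult_integrable:
  assumes "f \<in> L2_space M" "g \<in> L2_space M"
  shows "integrable M (\<lambda>t. f t * g t)"
proof (rule Bochner_Integration.integrable_bound)
  show "integrable M (\<lambda>t. (cmod (f t))\<^sup>2 + (cmod (g t))\<^sup>2)"
    using assms by (auto simp: L2_space_def)
  show "(\<lambda>t. f t * g t) \<in> borel_measurable M"
    using assms L2_measurable by measurable
  have "cmod (f t * g t) \<le> (cmod (f t))\<^sup>2 + (cmod (g t))\<^sup>2" for t
  proof -
    have "0 \<le> cmod (f t) * cmod (g t)" by simp
    then show ?thesis
      using sum_squares_bound[of "cmod (f t)" "cmod (g t)"] unfolding norm_mult by linarith
  qed
  then show "AE t in M. cmod (f t * g t) \<le> norm ((cmod (f t))\<^sup>2 + (cmod (g t))\<^sup>2)"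
    by (intro AE_I2) auto
qed

lemma L2_cnj: "f \<in> L2_space M \<Longrightarrow> (\<lambda>t. cnj (f t)) \<in> L2_space M"
  by (auto simp: L2_space_def)

lemma L2_bounded_mult:
  assumes f: "f \<in> L2_space M" and g: "g \<in> borel_measurable M" and B: "AE t in M. cmod (g t) \<le> B"
  shows "(\<lambda>t. g t * f t) \<in> L2_space M"
  unfolding L2_space_def
proof (intro CollectI conjI)
  have fm: "f \<in> borel_measurable M" using f by (rule L2_measurable)
  show m: "(\<lambda>t. g t * f t) \<in> borel_measurable M" using g fm by measurable
  show "integrable M (\<lambda>t. (cmod (g t * f t))\<^sup>2)"
  proof (rule Bochner_Integration.integrable_bound)
    show "integrable M (\<lambda>t. B\<^sup>2 * (cmod (f t))\<^sup>2)" using f by (auto simp: L2_space_def)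
    show "(\<lambda>t. (cmod (g t * f t))\<^sup>2) \<in> borel_measurable M" using m by measurable
    show "AE t in M. norm ((cmod (g t * f t))\<^sup>2) \<le> norm (B\<^sup>2 * (cmod (f t))\<^sup>2)"
      using B
    proof eventually_elim
      case (elim t)
      then have "(cmod (g t))\<^sup>2 \<le> B\<^sup>2" by (intro power_mono) auto
      then show ?case by (simp add: norm_mult power_mult_distrib mult_right_mono)
    qed
  qed
qed

lemma L2_lincomb:
  assumes f: "f \<in> L2_space M" and g: "g \<in> L2_space M"
  shows "(\<lambda>t. a * f t + b * g t) \<in> L2_space M"
  unfolding L2_space_def
proof (intro CollectI conjI)
  have fm: "f \<in> borel_measurable M" "g \<in> borel_measurable M" using f g L2_measurable by auto
  show m: "(\<lambda>t. a * f t + b * g t) \<in> borel_measurable M" using fm by measurable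
  show "integrable M (\<lambda>t. (cmod (a * f t + b * g t))\<^sup>2)"
  proof (rule Bochner_Integration.integrable_bound)
    show "integrable M (\<lambda>t. 2 * (cmod a)\<^sup>2 * (cmod (f t))\<^sup>2 + 2 * (cmod b)\<^sup>2 * (cmod (g t))\<^sup>2)"
      using f g by (auto simp: L2_space_def)
    show "(\<lambda>t. (cmod (a * f t + b * g t))\<^sup>2) \<in> borel_measurable M" using m by measurable
    show "AE t in M. norm ((cmod (a * f t + b * g t))\<^sup>2) \<le>
        norm (2 * (cmod a)\<^sup>2 * (cmod (f t))\<^sup>2 + 2 * (cmod b)\<^sup>2 * (cmod (g t))\<^sup>2)"
    proof (intro AE_I2)
      fix t
      have "(cmod (a * f t + b * g t))\<^sup>2 \<le> (cmod (a * f t) + cmod (b * g t))\<^sup>2"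
        by (intro power_mono norm_triangle_ineq) auto
      also have "\<dots> \<le> 2 * (cmod (a * f t))\<^sup>2 + 2 * (cmod (b * g t))\<^sup>2"
        using sum_squares_bound[of "cmod (a * f t)" "cmod (b * g t)"] by (simp add: power2_sum)
      finally show "norm ((cmod (a * f t + b * g t))\<^sup>2) \<le>
        norm (2 * (cmod a)\<^sup>2 * (cmod (f t))\<^sup>2 + 2 * (cmod b)\<^sup>2 * (cmod (g t))\<^sup>2)"
        by (simp add: norm_mult power_mult_distrib)
    qed
  qed
qed

lemma L2_ip_self: "L2_ip M f f = of_real (LINT t|M. (cmod (f t))\<^sup>2)"
proof -
  have "L2_ip M f f = (LINT t|M. of_real ((cmod (f t))\<^sup>2))"
    unfolding L2_ip_def by (simp only: complex_norm_square)
  then show ?thesis by (simp only: integral_complex_of_real)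
qed

interpretation L2: semi_inner_space "L2_space M" "L2_ip M" for M
proof
  show "(\<lambda>t. a * f t + b * g t) \<in> L2_space M" if "f \<in> L2_space M" "g \<in> L2_space M" for f g a b
    by (rule L2_lincomb[OF that])
  show "L2_ip M (\<lambda>t. a * f t + b * g t) h = a * L2_ip M f h + b * L2_ip M g h"
    if "f \<in> L2_space M" "g \<in> L2_space M" "h \<in> L2_space M" for f g h a b
    using L2_mult_integrable[OF that(1) L2_cnj[OF that(3)]] L2_mult_integrable[OF that(2) L2_cnj[OF that(3)]]
    by (simp add: L2_ip_def distrib_right mult.assoc)
  show "L2_ip M g f = cnj (L2_ip M f g)" for f g
    unfolding L2_ip_def by (subst Bochner_Integration.integral_cnj[symmetric]) (simp add: mult.commute)
  show "0 \<le> Re (L2_ip M f f)" for f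
    by (simp add: L2_ip_self)
qed

lemma L2_nrm: "L2.nrm M f = L2_norm M f"
  by (simp add: L2.nrm_def L2_norm_def L2_ip_self)

lemma L2_norm_nonneg [simp]: "0 \<le> L2_norm M f"
  by (simp add: L2_norm_def)

lemma L2_norm_eq_0_iff:
  assumes "f \<in> L2_space M"
  shows "L2_norm M f = 0 \<longleftrightarrow> (AE t in M. f t = 0)"
  using assms integral_nonneg_eq_0_iff_AE[of M "\<lambda>t. (cmod (f t))\<^sup>2"]
  by (simp add: L2_space_def L2_norm_def)

lemma L2_nn_integral:
  assumes "f \<in> L2_space M"
  shows "(\<integral>\<^sup>+t. ennreal ((cmod (f t))\<^sup>2) \<partial>M) = ennreal ((L2_norm M f)\<^sup>2)"
  using assms by (subst nn_integral_eq_integral) (auto simp: L2_space_def L2_norm_def)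

text \<open>The Riesz-Fischer theorem with a rate: the sequence converges almost everywhere, and
  Fatou's lemma carries the bound for \<open>f m - f n\<close> over to
  \<open>p - f n\<close>.\<close>

lemma L2_Cauchy_limit:
  assumes f: "\<And>n. f n \<in> L2_space M"
    and cau: "\<And>n m. n \<le> m \<Longrightarrow> L2_norm M (\<lambda>t. f m t - f n t) \<le> (1/2) ^ n"
  shows "\<exists>p\<in>L2_space M. \<forall>n. L2_norm M (\<lambda>t. p t - f n t) \<le> (1/2) ^ n"
proof -
  have fm [measurable]: "f n \<in> borel_measurable M" for n using f L2_measurable by blast
  \<comment> \<open>The weight \<open>2 ^ k\<close> leaves integrals of at most
    \<open>(1/2) ^ k\<close>, while \<open>2 * x \<le> 2 ^ k * x^2 + (1/2) ^ k\<close> bounds the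
    increments by a summable series.\<close>
  define d where "d = (\<lambda>k t. 2 ^ k * (cmod (f (Suc k) t - f k t))\<^sup>2)"
  have dm [measurable]: "d k \<in> borel_measurable M" for k unfolding d_def by measurable
  have "(\<integral>\<^sup>+t. (\<Sum>k. ennreal (d k t)) \<partial>M) = (\<Sum>k. \<integral>\<^sup>+t. ennreal (d k t) \<partial>M)"
    by (rule nn_integral_suminf) measurable
  also have "\<dots> \<le> (\<Sum>k. ennreal ((1/2) ^ k))"
  proof (rule suminf_le)
    fix k
    have "(\<integral>\<^sup>+t. ennreal (d k t) \<partial>M) =
        ennreal (2 ^ k) * (\<integral>\<^sup>+t. ennreal ((cmod (f (Suc k) t - f k t))\<^sup>2) \<partial>M)"
      unfolding d_def by (subst nn_integral_cmult[symmetric]) (auto simp: ennreal_mult)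
    also have "\<dots> = ennreal (2 ^ k * (L2_norm M (\<lambda>t. f (Suc k) t - f k t))\<^sup>2)"
      by (subst L2_nn_integral) (auto simp: ennreal_mult L2.minus_in f)
    also have "\<dots> \<le> ennreal (2 ^ k * ((1/2) ^ k)\<^sup>2)"
      using cau[of k "Suc k"]
      by (intro ennreal_leI mult_left_mono power_mono) auto
    also have "2 ^ k * ((1/2) ^ k)\<^sup>2 = (1/2::real) ^ k"
      by (simp add: power2_eq_square power_divide)
    finally show "(\<integral>\<^sup>+t. ennreal (d k t) \<partial>M) \<le> ennreal ((1/2) ^ k)" .
  qed auto
  also have "\<dots> = ennreal (\<Sum>k. (1/2) ^ k)" by (rule suminf_ennreal2) auto
  also have "\<dots> < \<infinity>" by simp
  finally have "AE t in M. (\<Sum>k. ennreal (d k t)) \<noteq> \<infinity>"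
    by (intro nn_integral_PInf_AE) auto
  then have conv: "AE t in M. (\<lambda>n. f n t) \<longlonglongrightarrow> lim (\<lambda>n. f n t)"
  proof eventually_elim
    case (elim t)
    then have "summable (\<lambda>k. d k t)"
      by (intro summable_suminf_not_top) (auto simp: d_def top_ennreal.rep_eq)
    then have "summable (\<lambda>k. d k t + (1/2) ^ k)" by (intro summable_add) auto
    moreover have "norm (f (Suc k) t - f k t) \<le> d k t + (1/2) ^ k" for k
    proof -
      let ?x = "cmod (f (Suc k) t - f k t)"
      have "2 ^ k * ?x * 2 \<le> (2 ^ k * ?x)\<^sup>2 + 1"
        using sum_squares_bound[of "2 ^ k * ?x" 1] by simp
      also have "\<dots> = 2 ^ k * (d k t + (1/2) ^ k)"
        by (simp add: d_def power2_eq_square algebra_simps power_divide)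
      finally have "2 * ?x \<le> d k t + (1/2) ^ k"
        by (simp add: mult.assoc)
      then show ?thesis using norm_ge_zero[of "f (Suc k) t - f k t"] by linarith
    qed
    ultimately have "summable (\<lambda>k. f (Suc k) t - f k t)"
      by (rule summable_comparison_test'[where N=0])
    then have "convergent (\<lambda>n. \<Sum>k<n. f (Suc k) t - f k t)"
      by (simp add: summable_iff_convergent)
    then have "convergent (\<lambda>n. f n t - f 0 t)" by (simp add: sum_lessThan_telescope[of "\<lambda>k. f k t"])
    then have "convergent (\<lambda>n. (f n t - f 0 t) + f 0 t)"
      by (intro convergent_add convergent_const)
    then show ?case by (simp add: convergent_LIMSEQ_iff)
  qed
  define p where "p = (\<lambda>t. lim (\<lambda>n. f n t))"
  have pm [measurable]: "p \<in> borel_measurable M"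
    unfolding p_def by (rule borel_measurable_lim_metric) simp
  have fatou: "(\<integral>\<^sup>+t. ennreal ((cmod (p t - f n t))\<^sup>2) \<partial>M) \<le> ennreal (((1/2) ^ n)\<^sup>2)" for n
  proof -
    have "(\<integral>\<^sup>+t. ennreal ((cmod (p t - f n t))\<^sup>2) \<partial>M) =
      (\<integral>\<^sup>+t. liminf (\<lambda>m. ennreal ((cmod (f m t - f n t))\<^sup>2)) \<partial>M)"
    proof (rule nn_integral_cong_AE)
      show "AE t in M. ennreal ((cmod (p t - f n t))\<^sup>2) = liminf (\<lambda>m. ennreal ((cmod (f m t - f n t))\<^sup>2))"
        using conv
      proof eventually_elim
        case (elim t)
        then have "(\<lambda>m. ennreal ((cmod (f m t - f n t))\<^sup>2)) \<longlonglongrightarrow> ennreal ((cmod (p t - f n t))\<^sup>2)"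
          unfolding p_def by (intro tendsto_intros)
        then show ?case by (rule lim_imp_Liminf[OF trivial_limit_sequentially, symmetric])
      qed
    qed
    also have "\<dots> \<le> liminf (\<lambda>m. \<integral>\<^sup>+t. ennreal ((cmod (f m t - f n t))\<^sup>2) \<partial>M)"
      by (rule nn_integral_liminf) measurable
    also have "\<dots> \<le> liminf (\<lambda>m. ennreal (((1/2) ^ n)\<^sup>2))"
    proof (rule Liminf_mono, rule eventually_sequentiallyI[of n])
      fix m assume "n \<le> m"
      then show "(\<integral>\<^sup>+t. ennreal ((cmod (f m t - f n t))\<^sup>2) \<partial>M) \<le> ennreal (((1/2) ^ n)\<^sup>2)"
        using cau[of n m]
        by (subst L2_nn_integral)
          (auto simp: L2.minus_in f intro!: ennreal_leI power_mono)
    qed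
    also have "\<dots> = ennreal (((1/2) ^ n)\<^sup>2)" by (simp add: Liminf_const)
    finally show ?thesis .
  qed
  have diff: "(\<lambda>t. p t - f n t) \<in> L2_space M" for n
    unfolding L2_space_def
    using fatou[of n] by (auto simp: integrable_iff_bounded intro: le_less_trans)
  have "p \<in> L2_space M"
    using L2_lincomb[OF diff[of 0] f[of 0], of 1 1] by simp
  moreover have "L2_norm M (\<lambda>t. p t - f n t) \<le> (1/2) ^ n" for n
  proof (rule power2_le_imp_le)
    have "ennreal ((L2_norm M (\<lambda>t. p t - f n t))\<^sup>2) \<le> ennreal (((1/2) ^ n)\<^sup>2)"
      using fatou[of n] L2_nn_integral[OF diff[of n]] by simp
    then show "(L2_norm M (\<lambda>t. p t - f n t))\<^sup>2 \<le> ((1/2) ^ n)\<^sup>2"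
      by (simp only: ennreal_le_iff zero_le_power2)
  qed simp
  ultimately show ?thesis by blast
qed

section \<open>Linear spans, projections, and criteria for completeness and minimality\<close>

lemma lin_span_lincomb:
  assumes "f \<in> lin_span v J" "g \<in> lin_span v J"
  shows "(\<lambda>t. a * f t + b * g t) \<in> lin_span v J"
proof -
  obtain F c where F: "finite F" "F \<subseteq> J" "f = (\<lambda>t. \<Sum>j\<in>F. c j * v j t)"
    using assms(1) by (auto simp: lin_span_def)
  obtain G d where G: "finite G" "G \<subseteq> J" "g = (\<lambda>t. \<Sum>j\<in>G. d j * v j t)"
    using assms(2) by (auto simp: lin_span_def)
  let ?e = "\<lambda>j. a * (if j \<in> F then c j else 0) + b * (if j \<in> G then d j else 0)"
  have ext: "(\<Sum>j\<in>F \<union> G. (if j \<in> H then u j else 0) * v j t) = (\<Sum>j\<in>H. u j * v j t)"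
    if "H \<subseteq> F \<union> G" for H u t
    using F(1) G(1) that by (intro sum.mono_neutral_cong_right) auto
  have "a * f t + b * g t = (\<Sum>j\<in>F \<union> G. ?e j * v j t)" for t
    using ext[of F c t] ext[of G d t]
    by (simp add: F(3) G(3) sum.distrib distrib_right mult.assoc flip: sum_distrib_left)
  then show ?thesis
    unfolding lin_span_def using F(1,2) G(1,2)
    by (intro CollectI exI[of _ "F \<union> G"] exI[of _ ?e]) auto
qed

lemma lin_span_induct [consumes 1, case_names zero step]:
  assumes "f \<in> lin_span v J" and zero: "P (\<lambda>t. 0)"
    and step: "\<And>f j a. P f \<Longrightarrow> j \<in> J \<Longrightarrow> P (\<lambda>t. 1 * f t + a * v j t)"
  shows "P f"
proof -
  obtain F c where F: "finite F" "F \<subseteq> J" "f = (\<lambda>t. \<Sum>j\<in>F. c j * v j t)"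
    using assms(1) by (auto simp: lin_span_def)
  have "P (\<lambda>t. \<Sum>j\<in>F. c j * v j t)"
    using F(1,2)
  proof (induction F)
    case (insert j F)
    have "(\<lambda>t. \<Sum>i\<in>insert j F. c i * v i t) = (\<lambda>t. 1 * (\<Sum>i\<in>F. c i * v i t) + c j * v j t)"
      using insert.hyps by (simp add: add.commute)
    then show ?case using step[of _ j "c j"] insert by simp
  qed (simp add: zero)
  then show ?thesis using F by simp
qed

lemma lin_span_in:
  assumes "j \<in> J" shows "v j \<in> lin_span v J"
  unfolding lin_span_def by (rule CollectI, rule exI[of _ "{j}"], rule exI[of _ "\<lambda>_. 1"]) (use assms in auto)

lemma lin_span_zero: "(\<lambda>t. 0) \<in> lin_span v J"
  unfolding lin_span_def by (rule CollectI, rule exI[of _ "{}"]) auto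

lemma L2_zero: "(\<lambda>t. 0) \<in> L2_space M"
  by (simp add: L2_space_def)

lemma lin_span_subset_L2:
  assumes v: "\<And>j. j \<in> J \<Longrightarrow> v j \<in> L2_space M" and "f \<in> lin_span v J"
  shows "f \<in> L2_space M"
  using assms(2)
proof (induction rule: lin_span_induct)
  case (step f j a)
  then show ?case using L2_lincomb v by blast
qed (rule L2_zero)

lemma L2_ip_lin_span_eq_0:
  assumes v: "\<And>j. j \<in> J \<Longrightarrow> v j \<in> L2_space M" and "g \<in> lin_span v J"
    and f: "f \<in> L2_space M" "\<And>j. j \<in> J \<Longrightarrow> L2_ip M f (v j) = 0"
  shows "L2_ip M f g = 0"
proof -
  have "g \<in> L2_space M \<and> L2_ip M f g = 0"
    using assms(2)
  proof (induction rule: lin_span_induct)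
    case zero
    then show ?case by (simp add: L2_zero L2_ip_def)
  next
    case (step g j a)
    then have g: "g \<in> L2_space M" "L2_ip M f g = 0" by auto
    show ?case
      using L2_lincomb[OF g(1) v[OF step.hyps], of 1 a]
        L2.ip_lincomb_right[OF g(1) v[OF step.hyps] f(1), of 1 a] g(2) f(2)[OF step.hyps] by simp
  qed
  then show ?thesis by simp
qed

lemma L2_projection:
  assumes v: "\<And>j. j \<in> J \<Longrightarrow> v j \<in> L2_space M" and f: "f \<in> L2_space M"
  shows "\<exists>p\<in>L2_closed_span M v J. \<forall>j\<in>J. L2_ip M (\<lambda>t. f t - p t) (v j) = 0"
proof -
  have "\<exists>p\<in>L2_space M. (\<forall>\<epsilon>>0. \<exists>g\<in>lin_span v J. L2.nrm M (\<lambda>t. p t - g t) < \<epsilon>) \<and>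
      (\<forall>g\<in>lin_span v J. L2_ip M (\<lambda>t. f t - p t) g = 0)"
  proof (rule L2.projection[OF _ _ _ f])
    show "lin_span v J \<subseteq> L2_space M" by (rule subsetI, rule lin_span_subset_L2[OF v])
    show "lin_span v J \<noteq> {}" using lin_span_zero[of v J] by auto
    show "(\<lambda>t. a * f t + b * g t) \<in> lin_span v J"
      if "f \<in> lin_span v J" "g \<in> lin_span v J" for f g a b
      using that by (rule lin_span_lincomb)
    show "\<exists>p\<in>L2_space M. \<forall>n. L2.nrm M (\<lambda>t. p t - g n t) \<le> (1/2) ^ n"
      if "\<And>n. g n \<in> L2_space M"
        "\<And>n m. n \<le> m \<Longrightarrow> L2.nrm M (\<lambda>t. g m t - g n t) \<le> (1/2) ^ n" for g
      using that unfolding L2_nrm by (rule L2_Cauchy_limit)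
  qed
  then obtain p where p: "p \<in> L2_space M"
      "\<And>\<epsilon>. \<epsilon> > 0 \<Longrightarrow> \<exists>g\<in>lin_span v J. L2_norm M (\<lambda>t. p t - g t) < \<epsilon>"
      "\<And>g. g \<in> lin_span v J \<Longrightarrow> L2_ip M (\<lambda>t. f t - p t) g = 0"
    unfolding L2_nrm by auto
  have c: "p \<in> L2_closed_span M v J" using p(1,2) by (simp add: L2_closed_span_def)
  have orth: "\<forall>j\<in>J. L2_ip M (\<lambda>t. f t - p t) (v j) = 0"
    using p(3) lin_span_in[of _ J v] by auto
  show ?thesis by (rule bexI[where x=p]) (rule orth, rule c)
qed

text \<open>Orthogonality to the span passes to limits by the Cauchy-Schwarz inequality.\<close>

lemma L2_ip_closed_span_eq_0:
  assumes v: "\<And>j. j \<in> J \<Longrightarrow> v j \<in> L2_space M" and p: "p \<in> L2_closed_span M v J"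
    and f: "f \<in> L2_space M" "\<And>j. j \<in> J \<Longrightarrow> L2_ip M f (v j) = 0"
  shows "L2_ip M f p = 0"
proof -
  have pL: "p \<in> L2_space M" using p by (simp add: L2_closed_span_def)
  have "cmod (L2_ip M f p) \<le> 0 + e" if "e > 0" for e
  proof -
    have pos: "0 < e / (L2_norm M f + 1)"
      using that by (intro divide_pos_pos) (auto simp: add_nonneg_pos)
    then obtain g where g: "g \<in> lin_span v J" "L2_norm M (\<lambda>t. p t - g t) < e / (L2_norm M f + 1)"
      using p by (auto simp: L2_closed_span_def)
    have gL: "g \<in> L2_space M" using lin_span_subset_L2[OF v g(1)] .
    have dL: "(\<lambda>t. p t - g t) \<in> L2_space M" by (rule L2.minus_in[OF pL gL])
    have "L2_ip M f (\<lambda>t. p t - g t) = L2_ip M f p"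
      using L2.ip_lincomb_right[OF pL gL f(1), of 1 "-1"] L2_ip_lin_span_eq_0[OF v g(1) f] by simp
    then have "cmod (L2_ip M f p) \<le> L2_norm M f * L2_norm M (\<lambda>t. p t - g t)"
      using L2.ip_Cauchy_Schwarz[OF f(1) dL] by (simp add: L2_nrm)
    also have "\<dots> \<le> (L2_norm M f + 1) * (e / (L2_norm M f + 1))"
      using g(2) by (intro mult_mono) auto
    also have "\<dots> = e"
    proof -
      have "L2_norm M f + 1 \<noteq> 0" using L2_norm_nonneg[of M f] by linarith
      then show ?thesis by simp
    qed
    finally show ?thesis by simp
  qed
  then have "cmod (L2_ip M f p) \<le> 0" by (rule field_le_epsilon)
  then show ?thesis by simp
qed

text \<open>The residual of a projection onto the closed span is orthogonal to the whole system,
  hence null, so \<open>f\<close> is approximated as well as its projection.\<close>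

lemma L2_completeI:
  assumes v: "\<And>j. j \<in> J \<Longrightarrow> v j \<in> L2_space M"
    and zero: "\<And>f. f \<in> L2_space M \<Longrightarrow> (\<And>j. j \<in> J \<Longrightarrow> L2_ip M f (v j) = 0) \<Longrightarrow> L2_norm M f = 0"
  shows "L2_complete M v J"
  unfolding L2_complete_def
proof
  show "L2_closed_span M v J \<subseteq> L2_space M" by (auto simp: L2_closed_span_def)
  show "L2_space M \<subseteq> L2_closed_span M v J"
  proof
    fix f assume f: "f \<in> L2_space M"
    have "\<exists>p\<in>L2_closed_span M v J. \<forall>j\<in>J. L2_ip M (\<lambda>t. f t - p t) (v j) = 0"
      by (rule L2_projection) (use v f in auto)
    then obtain p where p: "p \<in> L2_closed_span M v J" "\<And>j. j \<in> J \<Longrightarrow> L2_ip M (\<lambda>t. f t - p t) (v j) = 0"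
      by auto
    have pL: "p \<in> L2_space M" using p(1) by (simp add: L2_closed_span_def)
    have n0: "L2_norm M (\<lambda>t. f t - p t) = 0"
      by (rule zero[OF L2.minus_in[OF f pL] p(2)])
    show "f \<in> L2_closed_span M v J"
      unfolding L2_closed_span_def
    proof (intro CollectI conjI allI impI f)
      fix e :: real assume "0 < e"
      then obtain g where g: "g \<in> lin_span v J" "L2_norm M (\<lambda>t. p t - g t) < e"
        using p(1) by (auto simp: L2_closed_span_def)
      have gL: "g \<in> L2_space M" using lin_span_subset_L2[OF v g(1)] .
      have "L2_norm M (\<lambda>t. f t - g t) \<le> L2_norm M (\<lambda>t. f t - p t) + L2_norm M (\<lambda>t. p t - g t)"
        using L2.nrm_triangle[OF L2.minus_in[OF f pL] L2.minus_in[OF pL gL]] by (simp add: L2_nrm)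
      then have "L2_norm M (\<lambda>t. f t - g t) < e" using g(2) n0 by simp
      then show "\<exists>g\<in>lin_span v J. L2_norm M (\<lambda>t. f t - g t) < e" using g(1) by blast
    qed
  qed
qed

text \<open>The dual function is orthogonal to the closed span of the other elements but not to
  \<open>v j\<close>.\<close>

lemma L2_minimalI:
  assumes v: "\<And>j. j \<in> J \<Longrightarrow> v j \<in> L2_space M"
    and dual: "\<And>j. j \<in> J \<Longrightarrow> \<exists>f\<in>L2_space M. L2_ip M f (v j) \<noteq> 0 \<and> (\<forall>i\<in>J-{j}. L2_ip M f (v i) = 0)"
  shows "L2_minimal M v J"
  unfolding L2_minimal_def
proof
  fix j assume j: "j \<in> J"
  from dual[OF j] obtain f where f: "f \<in> L2_space M"
    "L2_ip M f (v j) \<noteq> 0 \<and> (\<forall>i\<in>J-{j}. L2_ip M f (v i) = 0)" ..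
  show "v j \<notin> L2_closed_span M v (J - {j})"
  proof
    assume *: "v j \<in> L2_closed_span M v (J - {j})"
    have "L2_ip M f (v j) = 0"
    proof (rule L2_ip_closed_span_eq_0[OF _ * f(1)])
      show "v i \<in> L2_space M" if "i \<in> J - {j}" for i using that by (intro v) simp
      show "L2_ip M f (v i) = 0" if "i \<in> J - {j}" for i using that f(2) by simp
    qed
    then show False using f(2) by simp
  qed
qed

subsection \<open>The Fourier transform on \<open>(-pi, pi)\<close>\<close>

interpretation leb_pi: finite_measure leb_pi
  by (rule finite_measure_lebesgue_on) (auto intro: bounded_set_imp_lmeasurable)

text \<open>The exponential is not conjugated, so the transform is holomorphic in \<open>z\<close>.
  A zero at \<open>z\<close> means that the conjugate of \<open>f\<close> is orthogonal to
  \<open>expi z\<close>.\<close>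

definition FT :: "(real \<Rightarrow> complex) \<Rightarrow> complex \<Rightarrow> complex" where
  "FT f z = (LINT t|leb_pi. f t * expi z t)"

lemma continuous_measurable_leb_pi:
  "continuous_on UNIV g \<Longrightarrow> g \<in> borel_measurable leb_pi" for g :: "real \<Rightarrow> 'b::euclidean_space"
  by (rule continuous_imp_measurable_on_sets_lebesgue) (auto intro: continuous_on_subset)

lemma FT_integrable: "f \<in> L2_space leb_pi \<Longrightarrow> integrable leb_pi (\<lambda>t. f t * expi z t)"
  by (intro L2_mult_integrable expi_in_L2)

lemma FT_lincomb:
  assumes "f \<in> L2_space leb_pi" "g \<in> L2_space leb_pi"
  shows "FT (\<lambda>t. a * f t + b * g t) z = a * FT f z + b * FT g z"
  using FT_integrable[OF assms(1), of z] FT_integrable[OF assms(2), of z]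
  by (simp add: FT_def distrib_right mult.assoc)

lemma L2_integrable:
  assumes "f \<in> L2_space leb_pi" shows "integrable leb_pi f"
  using FT_integrable[OF assms, of 0] by (simp add: expi_def)

lemma L2_times_ii_id:
  assumes "f \<in> L2_space leb_pi"
  shows "(\<lambda>t. \<i> * of_real t * f t) \<in> L2_space leb_pi"
proof (rule L2_bounded_mult[OF assms])
  show "(\<lambda>t. \<i> * complex_of_real t) \<in> borel_measurable leb_pi"
    by (intro continuous_measurable_leb_pi continuous_intros)
  show "AE t in leb_pi. cmod (\<i> * complex_of_real t) \<le> pi"
    by (intro AE_I2) (auto simp: norm_mult)
qed

lemma norm_exp_remainder:
  fixes w :: complex
  shows "cmod (exp w - 1 - w) \<le> exp (cmod w) * (cmod w)\<^sup>2"
  using Taylor_exp_field[of w 1] by (simp add: power2_eq_square diff_diff_eq)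

text \<open>Differentiation under the integral by a direct estimate: the second-order remainder of
  the exponential is uniform for \<open>\<bar>t\<bar> \<le> pi\<close> and
  \<open>cmod h \<le> 1\<close>.\<close>

lemma FT_has_derivative:
  assumes f: "f \<in> L2_space leb_pi"
  shows "(FT f has_field_derivative FT (\<lambda>t. \<i> * of_real t * f t) z) (at z)"
proof -
  let ?D = "FT (\<lambda>t. \<i> * of_real t * f t) z"
  define C where "C = exp pi * pi\<^sup>2 * (LINT t|leb_pi. cmod (f t * expi z t))"
  have bound: "norm ((FT f (z + h) - FT f z) / h - ?D) \<le> cmod h * C" if h: "h \<noteq> 0" "cmod h \<le> 1" for h
  proof -
    have i1: "integrable leb_pi (\<lambda>t. f t * expi z t)" "integrable leb_pi (\<lambda>t. f t * expi (z + h) t)"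
      by (intro FT_integrable f)+
    have i2: "integrable leb_pi (\<lambda>t. \<i> * of_real t * f t * expi z t)"
      by (intro FT_integrable L2_times_ii_id f)
    have e: "expi (z + h) t = expi z t * exp (\<i> * h * of_real t)" for t
      by (simp add: expi_def algebra_simps exp_add)
    have "FT f (z + h) - FT f z - h * ?D =
      (LINT t|leb_pi. f t * expi z t * (exp (\<i> * h * of_real t) - 1 - \<i> * h * of_real t))"
    proof -
      have "FT f (z + h) - FT f z - h * ?D =
        (LINT t|leb_pi. f t * expi (z + h) t - f t * expi z t - h * (\<i> * of_real t * f t * expi z t))"
        unfolding FT_def using i1 i2 by simp
      also have "\<dots> = (LINT t|leb_pi. f t * expi z t * (exp (\<i> * h * of_real t) - 1 - \<i> * h * of_real t))"
        unfolding e by (intro Bochner_Integration.integral_cong refl) (simp add: algebra_simps)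
      finally show ?thesis .
    qed
    also have "cmod \<dots> \<le> (LINT t|leb_pi. (exp pi * pi\<^sup>2 * (cmod h)\<^sup>2) * cmod (f t * expi z t))"
    proof (rule Bochner_Integration.integral_norm_bound_integral)
      show "integrable leb_pi (\<lambda>t. f t * expi z t * (exp (\<i> * h * of_real t) - 1 - \<i> * h * of_real t))"
      proof -
        have "integrable leb_pi (\<lambda>t. f t * expi (z + h) t - f t * expi z t - h * (\<i> * of_real t * f t * expi z t))"
          by (intro Bochner_Integration.integrable_diff i1 integrable_mult_right i2)
        then show ?thesis unfolding e by (simp add: algebra_simps)
      qed
      show "integrable leb_pi (\<lambda>t. (exp pi * pi\<^sup>2 * (cmod h)\<^sup>2) * cmod (f t * expi z t))"
        by (intro integrable_mult_right integrable_norm i1)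
      fix t assume "t \<in> space leb_pi"
      then have t: "\<bar>t\<bar> \<le> pi" by auto
      let ?w = "\<i> * h * of_real t"
      have w: "cmod ?w = cmod h * \<bar>t\<bar>" by (simp add: norm_mult)
      have "cmod ?w \<le> cmod h * pi" unfolding w using t by (intro mult_left_mono) auto
      moreover have "cmod h * pi \<le> 1 * pi" using h by (intro mult_right_mono) auto
      ultimately have w2: "cmod ?w \<le> cmod h * pi" "cmod ?w \<le> pi" by linarith+
      have "cmod (exp ?w - 1 - ?w) \<le> exp (cmod ?w) * (cmod ?w)\<^sup>2" by (rule norm_exp_remainder)
      also have "\<dots> \<le> exp pi * (cmod h * pi)\<^sup>2"
        using w2 by (intro mult_mono power_mono) auto
      finally have "cmod (exp ?w - 1 - ?w) \<le> exp pi * pi\<^sup>2 * (cmod h)\<^sup>2"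
        by (simp add: power_mult_distrib mult_ac)
      then have "cmod (f t * expi z t) * cmod (exp ?w - 1 - ?w) \<le>
          cmod (f t * expi z t) * (exp pi * pi\<^sup>2 * (cmod h)\<^sup>2)"
        by (intro mult_left_mono) auto
      then show "cmod (f t * expi z t * (exp ?w - 1 - ?w)) \<le> (exp pi * pi\<^sup>2 * (cmod h)\<^sup>2) * cmod (f t * expi z t)"
        by (simp add: norm_mult mult_ac)
    qed
    also have "\<dots> = (cmod h)\<^sup>2 * C" by (simp add: C_def)
    finally have "cmod (FT f (z + h) - FT f z - h * ?D) \<le> (cmod h)\<^sup>2 * C" .
    then have "cmod (FT f (z + h) - FT f z - h * ?D) / cmod h \<le> cmod h * C"
      using h by (simp add: divide_le_eq power2_eq_square mult_ac)
    moreover have "(FT f (z + h) - FT f z) / h - ?D = (FT f (z + h) - FT f z - h * ?D) / h"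
      using h by (simp add: field_simps)
    ultimately show ?thesis by (simp add: norm_divide)
  qed
  have "((\<lambda>h. (FT f (z + h) - FT f z) / h - ?D) \<longlongrightarrow> 0) (at 0)"
  proof (rule Lim_null_comparison)
    have "eventually (\<lambda>h. h \<in> ball 0 1 - {0}) (at (0::complex))"
      by (rule eventually_at_in_open) auto
    then show "eventually (\<lambda>h. norm ((FT f (z + h) - FT f z) / h - ?D) \<le> cmod h * C) (at 0)"
      by eventually_elim (use bound in auto)
    show "((\<lambda>h. cmod h * C) \<longlongrightarrow> 0) (at 0)"
      by (auto intro!: tendsto_eq_intros)
  qed
  then show ?thesis
    by (simp add: DERIV_def LIM_zero_iff)
qed

lemma FT_holomorphic: "f \<in> L2_space leb_pi \<Longrightarrow> FT f holomorphic_on UNIV"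
  unfolding holomorphic_on_def field_differentiable_def
  using FT_has_derivative has_field_derivative_at_within by blast

lemma deriv_FT: "f \<in> L2_space leb_pi \<Longrightarrow> deriv (FT f) z = FT (\<lambda>t. \<i> * of_real t * f t) z"
  by (rule DERIV_imp_deriv) (rule FT_has_derivative)

section \<open>Injectivity of the Fourier transform\<close>

text \<open>Differentiating the transform multiplies the function by \<open>\<i> * t\<close>, so
  induction on \<open>n\<close> reaches all powers of \<open>t\<close>.\<close>

lemma FT_zero_moments:
  assumes f: "f \<in> L2_space leb_pi" and zero: "\<And>z. FT f z = 0"
  shows "(\<lambda>t. of_real t ^ n * f t) \<in> L2_space leb_pi \<and> (\<forall>z. FT (\<lambda>t. of_real t ^ n * f t) z = 0)"
proof (induction n)
  case (Suc n)
  let ?g = "\<lambda>t. of_real t ^ n * f t"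
  have g: "?g \<in> L2_space leb_pi" and "FT ?g = (\<lambda>z. 0)" using Suc by auto
  then have d: "FT (\<lambda>t. \<i> * of_real t * ?g t) z = 0" for z
    using deriv_FT[OF g, of z] by simp
  have eq: "(\<lambda>t. of_real t ^ Suc n * f t) =
      (\<lambda>t. (-\<i>) * (\<lambda>t. \<i> * of_real t * ?g t) t + 0 * (\<lambda>t. \<i> * of_real t * ?g t) t)"
    by (simp add: mult_ac)
  show ?case
    unfolding eq using FT_lincomb[OF L2_times_ii_id[OF g] L2_times_ii_id[OF g], of "-\<i>" 0] d
      L2_lincomb[OF L2_times_ii_id[OF g] L2_times_ii_id[OF g], of "-\<i>" 0] by simp
qed (use assms in auto)

text \<open>At \<open>z = 0\<close> the vanishing transforms are moments, so \<open>f\<close>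
  annihilates polynomials, which are uniformly dense by the Weierstrass theorem.\<close>

lemma FT_zero_continuous:
  assumes f: "f \<in> L2_space leb_pi" and zero: "\<And>z. FT f z = 0"
    and h: "continuous_on UNIV (h :: real \<Rightarrow> real)"
  shows "(LINT t|leb_pi. of_real (h t) * f t) = 0"
proof -
  have poly: "integrable leb_pi (\<lambda>t. of_real (p t) * f t) \<and> (LINT t|leb_pi. of_real (p t) * f t) = 0"
    if pf: "polynomial_function p" for p :: "real \<Rightarrow> real"
  proof -
    obtain a n where p: "p = (\<lambda>x. \<Sum>i\<le>n. a i * x ^ i)"
      using pf real_polynomial_function_iff_sum[of p] real_polynomial_function_eq[of p] by auto
    have eq: "of_real (p t) * f t = (\<Sum>i\<le>n. of_real (a i) * (of_real t ^ i * f t))" for t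
      by (simp add: p sum_distrib_right mult.assoc)
    have int: "integrable leb_pi (\<lambda>t. of_real t ^ i * f t)" for i
      using FT_zero_moments[OF f zero, of i] L2_integrable by auto
    moreover have "(LINT t|leb_pi. of_real t ^ i * f t) = 0" for i
    proof -
      have "FT (\<lambda>t. of_real t ^ i * f t) 0 = 0" using FT_zero_moments[OF f zero] by auto
      then show ?thesis by (simp add: FT_def expi_def)
    qed
    ultimately show ?thesis unfolding eq by simp
  qed
  have B: "(\<lambda>t. complex_of_real (h t)) \<in> borel_measurable leb_pi"
    by (intro continuous_measurable_leb_pi continuous_intros h)
  have "compact (h ` {-pi..pi})"
    by (intro compact_continuous_image continuous_on_subset[OF h]) auto
  then obtain K where K: "\<And>t. t \<in> {-pi..pi} \<Longrightarrow> \<bar>h t\<bar> \<le> K"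
    using compact_imp_bounded bounded_iff by (metis image_eqI real_norm_def)
  have hint: "integrable leb_pi (\<lambda>t. of_real (h t) * f t)"
    by (intro L2_integrable L2_bounded_mult[OF f B, of K] AE_I2) (use K in auto)
  let ?I = "LINT t|leb_pi. cmod (f t)"
  have I0: "0 \<le> ?I" by simp
  have "cmod (LINT t|leb_pi. of_real (h t) * f t) \<le> 0 + e" if "e > 0" for e
  proof -
    define d where "d = e / (?I + 1)"
    have d: "d > 0" using that I0 by (simp add: d_def add_nonneg_pos)
    have "continuous_on {-pi..pi} h" by (rule continuous_on_subset[OF h]) auto
    from Stone_Weierstrass_polynomial_function[OF compact_Icc this d]
    obtain p where p: "polynomial_function p" "\<And>t. t \<in> {-pi..pi} \<Longrightarrow> norm (h t - p t) < d"
      by auto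
    have "(LINT t|leb_pi. of_real (h t) * f t) =
        (LINT t|leb_pi. of_real (h t) * f t - of_real (p t) * f t)"
      using hint poly[OF p(1)] by simp
    also have "cmod \<dots> \<le> (LINT t|leb_pi. d * cmod (f t))"
    proof (rule Bochner_Integration.integral_norm_bound_integral)
      show "integrable leb_pi (\<lambda>t. of_real (h t) * f t - of_real (p t) * f t)"
        using hint poly[OF p(1)] by simp
      show "integrable leb_pi (\<lambda>t. d * cmod (f t))"
        using L2_integrable[OF f] by simp
      fix t assume "t \<in> space leb_pi"
      then have t: "t \<in> {-pi..pi}" by simp
      have "of_real (h t) * f t - of_real (p t) * f t = of_real (h t - p t) * f t"
        by (simp add: algebra_simps)
      then show "cmod (of_real (h t) * f t - of_real (p t) * f t) \<le> d * cmod (f t)"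
        using p(2)[OF t] by (simp only: norm_mult norm_of_real) (intro mult_right_mono, auto)
    qed
    also have "\<dots> = d * ?I" by simp
    also have "\<dots> \<le> d * (?I + 1)" using d by simp
    also have "\<dots> = e"
    proof -
      have "?I + 1 \<noteq> 0" using I0 by linarith
      then show ?thesis by (simp add: d_def)
    qed
    finally show ?thesis by simp
  qed
  then have "cmod (LINT t|leb_pi. of_real (h t) * f t) \<le> 0" by (rule field_le_epsilon)
  then show ?thesis by simp
qed

text \<open>The sign of \<open>Re (f t)\<close> is a limit almost everywhere of continuous
  functions, all of which integrate to 0 against \<open>f\<close>. Hence the integral of
  \<open>\<bar>Re (f t)\<bar>\<close> is 0.\<close>

lemma FT_zero_Re:
  assumes f: "f \<in> L2_space leb_pi" and zero: "\<And>z. FT f z = 0"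
  shows "AE t in leb_pi. Re (f t) = 0"
proof -
  have fm [measurable]: "f \<in> borel_measurable leb_pi" using f by (rule L2_measurable)
  have intf: "integrable leb_pi f" by (rule L2_integrable[OF f])
  have "(\<lambda>t. sgn (Re (f t))) \<in> borel_measurable leb_pi" by measurable
  then have "(\<lambda>t. sgn (Re (f t))) measurable_on {-pi<..<pi}"
    by (subst measurable_on_iff_borel_measurable) auto
  then obtain N g where N: "negligible N" and g: "\<And>n. continuous_on UNIV (g n)"
    "\<And>t. t \<notin> N \<Longrightarrow> (\<lambda>n. g n t) \<longlonglongrightarrow> (if t \<in> {-pi<..<pi} then sgn (Re (f t)) else 0)"
    unfolding measurable_on_def by blast
  \<comment> \<open>Clipping to \<open>[-1, 1]\<close> provides the dominating function
    \<open>cmod (f t)\<close> and does not alter the limit.\<close>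
  define c where "c = (\<lambda>n t. max (-1) (min 1 (g n t)))"
  have c: "continuous_on UNIV (c n)" for n unfolding c_def by (intro continuous_intros g)
  have cm [measurable]: "c n \<in> borel_measurable leb_pi" for n
    by (rule continuous_measurable_leb_pi[OF c])
  have "(\<lambda>n. LINT t|leb_pi. c n t * Re (f t)) \<longlonglongrightarrow> (LINT t|leb_pi. \<bar>Re (f t)\<bar>)"
  proof (rule integral_dominated_convergence)
    show "(\<lambda>t. \<bar>Re (f t)\<bar>) \<in> borel_measurable leb_pi" by measurable
    show "(\<lambda>t. c n t * Re (f t)) \<in> borel_measurable leb_pi" for n by measurable
    show "integrable leb_pi (\<lambda>t. cmod (f t))" using intf by simp
    show "AE t in leb_pi. norm (c n t * Re (f t)) \<le> cmod (f t)" for n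
    proof (rule AE_I2)
      fix t
      have "\<bar>c n t\<bar> * \<bar>Re (f t)\<bar> \<le> 1 * cmod (f t)"
        by (intro mult_mono abs_Re_le_cmod) (auto simp: c_def)
      then show "norm (c n t * Re (f t)) \<le> cmod (f t)" by (simp add: abs_mult)
    qed
    have "AE t in lebesgue. t \<notin> N"
      using N AE_not_in negligible_iff_null_sets by blast
    then have "AE t in leb_pi. t \<notin> N"
      by (subst AE_restrict_space_iff) (auto elim: eventually_mono)
    moreover have "AE t in leb_pi. t \<in> {-pi<..<pi}" by (rule AE_I2) simp
    ultimately show "AE t in leb_pi. (\<lambda>n. c n t * Re (f t)) \<longlonglongrightarrow> \<bar>Re (f t)\<bar>"
    proof eventually_elim
      case (elim t)
      then have "(\<lambda>n. g n t) \<longlonglongrightarrow> sgn (Re (f t))" using g(2)[of t] by simp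
      then have "(\<lambda>n. c n t * Re (f t)) \<longlonglongrightarrow> max (-1) (min 1 (sgn (Re (f t)))) * Re (f t)"
        unfolding c_def by (intro tendsto_intros)
      moreover have "max (-1) (min 1 (sgn (Re (f t)))) * Re (f t) = \<bar>Re (f t)\<bar>"
        by (auto simp: sgn_if)
      ultimately show ?case by simp
    qed
  qed
  moreover have "(LINT t|leb_pi. c n t * Re (f t)) = 0" for n
  proof -
    have m: "(\<lambda>t. complex_of_real (c n t)) \<in> borel_measurable leb_pi" by measurable
    have "integrable leb_pi (\<lambda>t. of_real (c n t) * f t)"
      by (intro L2_integrable L2_bounded_mult[OF f m, of 1] AE_I2) (auto simp: c_def)
    then have "(LINT t|leb_pi. Re (of_real (c n t) * f t)) = Re (LINT t|leb_pi. of_real (c n t) * f t)"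
      by (rule integral_Re)
    then show ?thesis using FT_zero_continuous[OF f zero c[of n]] by simp
  qed
  ultimately have "(LINT t|leb_pi. \<bar>Re (f t)\<bar>) = 0"
    by (simp add: LIMSEQ_const_iff)
  then have "AE t in leb_pi. \<bar>Re (f t)\<bar> = 0"
    using intf by (subst (asm) integral_nonneg_eq_0_iff_AE) auto
  then show ?thesis by simp
qed

text \<open>The imaginary part of \<open>f\<close> is the real part of
  \<open>-\<i> * f\<close>.\<close>

lemma FT_injective:
  assumes f: "f \<in> L2_space leb_pi" and zero: "\<And>z. FT f z = 0"
  shows "AE t in leb_pi. f t = 0"
proof -
  let ?g = "\<lambda>t. (-\<i>) * f t + 0 * f t"
  have "AE t in leb_pi. Re (f t) = 0" by (rule FT_zero_Re[OF assms])
  moreover have "AE t in leb_pi. Re (?g t) = 0"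
    by (rule FT_zero_Re[OF L2_lincomb[OF f f]]) (simp only: FT_lincomb[OF f f] zero, simp)
  ultimately show ?thesis by eventually_elim (simp add: complex_eq_iff)
qed

subsection \<open>Integration and multiplication by the independent variable\<close>

text \<open>The integral of \<open>f\<close> from \<open>-pi\<close> to \<open>t\<close>, written
  over the fixed measure so that Fubini's theorem applies.\<close>

definition volterra :: "(real \<Rightarrow> complex) \<Rightarrow> real \<Rightarrow> complex" where
  "volterra f t = (LINT u|leb_pi. (if u < t then f u else 0))"

text \<open>The integral from \<open>u\<close> to \<open>pi\<close>: the transpose of
  \<open>volterra\<close> for the pairing without conjugation.\<close>

definition volterra_adj :: "(real \<Rightarrow> complex) \<Rightarrow> real \<Rightarrow> complex" where
  "volterra_adj f u = (LINT t|leb_pi. (if u < t then f t else 0))"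

lemma id_measurable_leb_pi [measurable]: "(\<lambda>t::real. t) \<in> borel_measurable leb_pi"
  by (intro continuous_measurable_leb_pi continuous_intros)

lemma less_measurable_leb_pi_pair:
  "{x \<in> space (leb_pi \<Otimes>\<^sub>M leb_pi). fst x < snd x} \<in> sets (leb_pi \<Otimes>\<^sub>M leb_pi)"
proof -
  have [measurable]: "(\<lambda>x. fst x) \<in> borel_measurable (leb_pi \<Otimes>\<^sub>M leb_pi)"
    by (rule measurable_compose[OF measurable_fst id_measurable_leb_pi])
  have [measurable]: "(\<lambda>x. snd x) \<in> borel_measurable (leb_pi \<Otimes>\<^sub>M leb_pi)"
    by (rule measurable_compose[OF measurable_snd id_measurable_leb_pi])
  show ?thesis by measurable
qed

lemma volterra_Fubini:
  assumes f: "integrable leb_pi f" and g: "integrable leb_pi g"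
  shows "(LINT t|leb_pi. volterra f t * g t) = (LINT u|leb_pi. f u * volterra_adj g u)"
proof -
  interpret P: pair_sigma_finite leb_pi leb_pi ..
  have fm: "f \<in> borel_measurable leb_pi" and gm: "g \<in> borel_measurable leb_pi"
    using f g by auto
  have fm1: "(\<lambda>x. f (fst x)) \<in> borel_measurable (leb_pi \<Otimes>\<^sub>M leb_pi)"
    by (rule measurable_compose[OF measurable_fst fm])
  have gm1: "(\<lambda>x. g (snd x)) \<in> borel_measurable (leb_pi \<Otimes>\<^sub>M leb_pi)"
    by (rule measurable_compose[OF measurable_snd gm])
  have m: "(\<lambda>x. f (fst x) * g (snd x)) \<in> borel_measurable (leb_pi \<Otimes>\<^sub>M leb_pi)"
    by (rule borel_measurable_times[OF fm1 gm1])
  have int: "integrable (leb_pi \<Otimes>\<^sub>M leb_pi) (\<lambda>x. f (fst x) * g (snd x))"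
  proof (rule P.Fubini_integrable[OF m])
    show "integrable leb_pi (\<lambda>x. LINT y|leb_pi. norm (f (fst (x, y)) * g (snd (x, y))))"
      using f by (simp add: norm_mult)
    show "AE x in leb_pi. integrable leb_pi (\<lambda>y. f (fst (x, y)) * g (snd (x, y)))"
      using g by simp
  qed
  define F where "F = (\<lambda>u t. if u < t then f u * g t else 0)"
  have "integrable (leb_pi \<Otimes>\<^sub>M leb_pi) (case_prod F)"
  proof (rule Bochner_Integration.integrable_bound[OF int])
    have "(\<lambda>x. if fst x < snd x then f (fst x) * g (snd x) else 0) \<in> borel_measurable (leb_pi \<Otimes>\<^sub>M leb_pi)"
      by (rule measurable_If[OF m _ less_measurable_leb_pi_pair]) simp
    then show "case_prod F \<in> borel_measurable (leb_pi \<Otimes>\<^sub>M leb_pi)"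
      by (simp add: F_def case_prod_beta')
    show "AE x in leb_pi \<Otimes>\<^sub>M leb_pi. norm (case_prod F x) \<le> norm (f (fst x) * g (snd x))"
      by (rule AE_I2) (auto simp: F_def)
  qed
  then have "(LINT t|leb_pi. LINT u|leb_pi. F u t) = (LINT u|leb_pi. LINT t|leb_pi. F u t)"
    by (rule P.Fubini_integral)
  moreover have "(LINT u|leb_pi. F u t) = volterra f t * g t" for t
  proof -
    have "(LINT u|leb_pi. F u t) = (LINT u|leb_pi. (if u < t then f u else 0) * g t)"
      unfolding F_def by (intro Bochner_Integration.integral_cong) auto
    then show ?thesis by (simp add: volterra_def)
  qed
  moreover have "(LINT t|leb_pi. F u t) = f u * volterra_adj g u" for u
  proof -
    have "(LINT t|leb_pi. F u t) = (LINT t|leb_pi. f u * (if u < t then g t else 0))"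
      unfolding F_def by (intro Bochner_Integration.integral_cong) auto
    then show ?thesis by (simp add: volterra_adj_def)
  qed
  ultimately show ?thesis by simp
qed

lemma volterra_integrable:
  fixes f :: "real \<Rightarrow> complex"
  assumes f: "integrable leb_pi f"
  shows "integrable leb_pi (\<lambda>u. if u < t then f u else 0)" "integrable leb_pi (\<lambda>u. if t < u then f u else 0)"
proof -
  have [measurable]: "f \<in> borel_measurable leb_pi" using f by auto
  show "integrable leb_pi (\<lambda>u. if u < t then f u else 0)"
    by (rule Bochner_Integration.integrable_bound[OF f]) auto
  show "integrable leb_pi (\<lambda>u. if t < u then f u else 0)"
    by (rule Bochner_Integration.integrable_bound[OF f]) auto
qed

lemma volterra_measurable:
  assumes f: "integrable leb_pi f"
  shows "volterra f \<in> borel_measurable leb_pi"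
proof -
  have fm: "f \<in> borel_measurable leb_pi" using f by auto
  have fm1: "(\<lambda>x. f (snd x)) \<in> borel_measurable (leb_pi \<Otimes>\<^sub>M leb_pi)"
    by (rule measurable_compose[OF measurable_snd fm])
  have [measurable]: "(\<lambda>x. fst x) \<in> borel_measurable (leb_pi \<Otimes>\<^sub>M leb_pi)"
    by (rule measurable_compose[OF measurable_fst id_measurable_leb_pi])
  have [measurable]: "(\<lambda>x. snd x) \<in> borel_measurable (leb_pi \<Otimes>\<^sub>M leb_pi)"
    by (rule measurable_compose[OF measurable_snd id_measurable_leb_pi])
  have "{x \<in> space (leb_pi \<Otimes>\<^sub>M leb_pi). snd x < fst x} \<in> sets (leb_pi \<Otimes>\<^sub>M leb_pi)"
    by measurable
  then have "(\<lambda>x. if snd x < fst x then f (snd x) else 0) \<in> borel_measurable (leb_pi \<Otimes>\<^sub>M leb_pi)"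
    by (intro measurable_If fm1) auto
  then have "(\<lambda>t. LINT u|leb_pi. (if u < t then f u else 0)) \<in> borel_measurable leb_pi"
    by (intro leb_pi.borel_measurable_lebesgue_integral) (simp add: case_prod_beta')
  then show ?thesis by (simp add: volterra_def[abs_def])
qed

lemma volterra_bounded:
  assumes f: "integrable leb_pi f"
  shows "cmod (volterra f t) \<le> (LINT u|leb_pi. cmod (f u))"
  unfolding volterra_def
  by (rule Bochner_Integration.integral_norm_bound_integral) (use volterra_integrable[OF f] f in auto)

text \<open>The two integrals split the interval at \<open>t\<close>, a null set. For a function
  with integral 0 the transpose is thus the negative of \<open>volterra\<close>.\<close>

lemma volterra_add_adj:
  assumes f: "integrable leb_pi f"
  shows "volterra f t + volterra_adj f t = (LINT u|leb_pi. f u)"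
proof -
  have "volterra f t + volterra_adj f t =
      (LINT u|leb_pi. (if u < t then f u else 0) + (if t < u then f u else 0))"
    unfolding volterra_def volterra_adj_def
    by (rule Bochner_Integration.integral_add[symmetric]) (rule volterra_integrable[OF f])+
  also have "\<dots> = (LINT u|leb_pi. f u)"
  proof (rule integral_cong_AE)
    have [measurable]: "f \<in> borel_measurable leb_pi" using f by auto
    show "(\<lambda>u. (if u < t then f u else 0) + (if t < u then f u else 0)) \<in> borel_measurable leb_pi"
      by measurable
    show "f \<in> borel_measurable leb_pi" by measurable
    have "AE u in lebesgue. u \<notin> {t}"
      using negligible_sing[of t] AE_not_in negligible_iff_null_sets by blast
    then have "AE u in leb_pi. u \<noteq> t"
      by (subst AE_restrict_space_iff) (auto elim: eventually_mono)
    then show "AE u in leb_pi. (if u < t then f u else 0) + (if t < u then f u else 0) = f u"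
      by eventually_elim auto
  qed
  finally show ?thesis .
qed

text \<open>The factor \<open>v\<close> stays on the left so that \<open>v = 0\<close> is covered
  without division.\<close>

lemma volterra_adj_expi:
  assumes u: "u \<in> {-pi<..<pi}"
  shows "v * volterra_adj (expi v) u = -\<i> * (expi v pi - expi v u)"
proof -
  have "((\<lambda>t. v * expi v t) has_integral (-\<i> * expi v pi - (-\<i> * expi v u))) {u..pi}"
  proof (rule fundamental_theorem_of_calculus)
    show "u \<le> pi" using u by simp
    fix t assume "t \<in> {u..pi}"
    have "((\<lambda>w. -\<i> * exp (\<i> * v * w)) has_field_derivative v * expi v t) (at (of_real t))"
      by (auto intro!: derivative_eq_intros simp: expi_def mult_ac)
    then have "((\<lambda>s. -\<i> * exp (\<i> * v * of_real s)) has_vector_derivative v * expi v t) (at t within {u..pi})"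
      by (rule has_vector_derivative_real_field)
    then show "((\<lambda>s. -\<i> * expi v s) has_vector_derivative v * expi v t) (at t within {u..pi})"
      by (simp add: expi_def)
  qed
  then have "((\<lambda>t. v * expi v t) has_integral (-\<i> * (expi v pi - expi v u))) {u<..<pi}"
    by (simp add: has_integral_Icc_iff_Ioo algebra_simps)
  then have "((\<lambda>t. if t \<in> {u<..<pi} then v * expi v t else 0) has_integral (-\<i> * (expi v pi - expi v u))) {-pi<..<pi}"
    by (subst has_integral_restrict) (use u in auto)
  then have "((\<lambda>t. v * (if u < t then expi v t else 0)) has_integral (-\<i> * (expi v pi - expi v u))) {-pi<..<pi}"
    by (rule has_integral_eq[rotated]) auto
  then have *: "integral {-pi<..<pi} (\<lambda>t. v * (if u < t then expi v t else 0)) = -\<i> * (expi v pi - expi v u)"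
    by (rule integral_unique)
  have "integrable leb_pi (\<lambda>t. v * (if u < t then expi v t else 0))"
    by (intro integrable_mult_right volterra_integrable L2_integrable expi_in_L2)
  then have "(LINT t|leb_pi. v * (if u < t then expi v t else 0)) = -\<i> * (expi v pi - expi v u)"
    unfolding *[symmetric] by (rule lebesgue_integral_eq_integral) simp
  then show ?thesis by (simp add: volterra_adj_def)
qed

text \<open>On the Fourier side, division by \<open>z - w\<close> is integration of \<open>f * expi w\<close> from \<open>-pi\<close>.\<close>

lemma FT_volterra:
  assumes f: "f \<in> L2_space leb_pi" and zero: "FT f w = 0"
  defines "g \<equiv> \<lambda>t. -\<i> * (volterra (\<lambda>u. f u * expi w u) t * expi (- w) t)"
  shows "g \<in> L2_space leb_pi" "(z - w) * FT g z = FT f z"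
proof -
  let ?f1 = "\<lambda>u. f u * expi w u"
  have f1: "integrable leb_pi ?f1" by (rule FT_integrable[OF f])
  have "(\<lambda>t. volterra ?f1 t * expi (- w) t) \<in> L2_space leb_pi"
    by (rule L2_bounded_mult[OF expi_in_L2 volterra_measurable[OF f1]], rule AE_I2, rule volterra_bounded[OF f1])
  from L2_lincomb[OF this this, of "-\<i>" 0] show "g \<in> L2_space leb_pi"
    by (simp add: g_def)
  define v where "v = z - w"
  have e: "expi (- w) t * expi z t = expi v t" for t
    by (simp add: expi_def v_def algebra_simps flip: exp_add)
  have e2: "expi w t * expi v t = expi z t" for t
    by (simp add: expi_def v_def algebra_simps flip: exp_add)
  have "FT g z = (LINT t|leb_pi. -\<i> * (volterra ?f1 t * expi v t))"
    unfolding FT_def g_def by (intro Bochner_Integration.integral_cong) (auto simp: mult.assoc e)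
  also have "\<dots> = -\<i> * (LINT u|leb_pi. ?f1 u * volterra_adj (expi v) u)"
    using volterra_Fubini[OF f1 L2_integrable[OF expi_in_L2[of v]]] by simp
  finally have "v * FT g z = -\<i> * (v * (LINT u|leb_pi. ?f1 u * volterra_adj (expi v) u))" by simp
  also have "v * (LINT u|leb_pi. ?f1 u * volterra_adj (expi v) u) =
      (LINT u|leb_pi. v * (?f1 u * volterra_adj (expi v) u))" by simp
  also have "\<dots> = (LINT u|leb_pi. (-\<i> * expi v pi) * ?f1 u + \<i> * (f u * expi z u))"
  proof (rule Bochner_Integration.integral_cong[OF refl])
    fix u assume "u \<in> space leb_pi"
    then have u: "u \<in> {-pi<..<pi}" by simp
    have "v * (?f1 u * volterra_adj (expi v) u) = ?f1 u * (v * volterra_adj (expi v) u)" by simp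
    also have "\<dots> = (-\<i> * expi v pi) * ?f1 u + \<i> * (f u * (expi w u * expi v u))"
      unfolding volterra_adj_expi[OF u] by (simp add: algebra_simps)
    finally show "v * (?f1 u * volterra_adj (expi v) u) = (-\<i> * expi v pi) * ?f1 u + \<i> * (f u * expi z u)"
      unfolding e2 .
  qed
  \<comment> \<open>The boundary term at \<open>pi\<close> carries the factor \<open>FT f w\<close>,
    which is 0.\<close>
  also have "\<dots> = (-\<i> * expi v pi) * FT f w + \<i> * FT f z"
    unfolding FT_def
    by (subst Bochner_Integration.integral_add)
      (intro integrable_mult_right FT_integrable f, intro integrable_mult_right FT_integrable f, simp)
  finally show "(z - w) * FT g z = FT f z"
    using zero by (simp add: v_def)
qed

text \<open>Division by \<open>z\<close> yields \<open>-\<i> * volterra f\<close>, whose transform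
  agrees with that of \<open>g\<close> off 0 and hence everywhere; injectivity concludes. In other
  words, \<open>f\<close> is \<open>\<i>\<close> times the derivative of \<open>g\<close>.\<close>

lemma FT_eq_mult_id_imp_volterra:
  assumes f: "f \<in> L2_space leb_pi" and g: "g \<in> L2_space leb_pi"
    and eq: "\<And>z. FT f z = z * FT g z"
  shows "AE t in leb_pi. g t = -\<i> * volterra f t"
proof -
  define g' where "g' = (\<lambda>t. -\<i> * volterra f t)"
  have e0: "expi 0 = (\<lambda>t. 1)" by (simp add: expi_def fun_eq_iff)
  have f0: "FT f 0 = 0" using eq[of 0] by simp
  have g': "g' \<in> L2_space leb_pi" "z * FT g' z = FT f z" for z
    using FT_volterra(1)[OF f f0] FT_volterra(2)[OF f f0, of z] by (simp_all add: g'_def e0)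
  define h where "h = (\<lambda>t. 1 * g t + (-1) * g' t)"
  have h: "h \<in> L2_space leb_pi" unfolding h_def by (rule L2_lincomb[OF g g'(1)])
  have "FT h z = FT g z - FT g' z" for z
    unfolding h_def FT_lincomb[OF g g'(1)] by simp
  then have nz: "FT h z = 0" if "z \<noteq> 0" for z
    using that eq[of z] g'(2)[of z] by auto
  have "FT h z = 0" for z by (rule entire_eq_0I[OF FT_holomorphic[OF h] nz])
  then have "AE t in leb_pi. h t = 0" by (rule FT_injective[OF h])
  then show ?thesis by eventually_elim (simp add: h_def g'_def add_eq_0_iff2)
qed

text \<open>Integration by parts for \<open>\<i> d/dt\<close>, carried out with Fubini's theorem for
  \<open>volterra\<close>. The value at \<open>z = 0\<close> shows that \<open>f'\<close> has
  integral 0, so no boundary term arises. The primes denote multiplication by \<open>z\<close>, not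
  derivatives.\<close>

lemma FT_mult_id_symmetric:
  assumes f: "f \<in> L2_space leb_pi" "f' \<in> L2_space leb_pi" and g: "g \<in> L2_space leb_pi" "g' \<in> L2_space leb_pi"
    and eqf: "\<And>z. FT f' z = z * FT f z" and eqg: "\<And>z. FT g' z = z * FT g z"
  shows "L2_ip leb_pi f' g = L2_ip leb_pi f g'"
proof -
  have int: "integrable leb_pi f'" "integrable leb_pi (\<lambda>t. cnj (g' t))"
    using L2_integrable f g L2_cnj by blast+
  have vcnj: "cnj (volterra g' t) = volterra (\<lambda>t. cnj (g' t)) t" for t
    unfolding volterra_def
    by (subst Bochner_Integration.integral_cnj[symmetric])
       (intro Bochner_Integration.integral_cong, auto)
  have f'0: "(LINT u|leb_pi. f' u) = 0"
    using eqf[of 0] by (simp add: FT_def expi_def)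
  have vm: "volterra g' \<in> borel_measurable leb_pi" "volterra f' \<in> borel_measurable leb_pi"
    using volterra_measurable L2_integrable f g by auto
  have "L2_ip leb_pi f' g = (LINT t|leb_pi. \<i> * (volterra (\<lambda>t. cnj (g' t)) t * f' t))"
    unfolding L2_ip_def
  proof (rule integral_cong_AE)
    show "(\<lambda>t. f' t * cnj (g t)) \<in> borel_measurable leb_pi"
      using f g L2_measurable by measurable
    show "(\<lambda>t. \<i> * (volterra (\<lambda>t. cnj (g' t)) t * f' t)) \<in> borel_measurable leb_pi"
      using L2_measurable[OF f(2)] volterra_measurable[OF int(2)] by measurable
    show "AE t in leb_pi. f' t * cnj (g t) = \<i> * (volterra (\<lambda>t. cnj (g' t)) t * f' t)"
      using FT_eq_mult_id_imp_volterra[OF g(2,1) eqg]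
      by eventually_elim (simp flip: vcnj)
  qed
  also have "\<dots> = \<i> * (LINT u|leb_pi. cnj (g' u) * volterra_adj f' u)"
    using volterra_Fubini[OF int(2,1)] by simp
  also have "\<dots> = \<i> * (LINT u|leb_pi. cnj (g' u) * (- volterra f' u))"
    using volterra_add_adj[OF int(1)] f'0 by (metis add_eq_0_iff)
  also have "\<dots> = (LINT u|leb_pi. (-\<i> * volterra f' u) * cnj (g' u))"
    by (subst integral_mult_right_zero[symmetric]) (simp add: mult_ac)
  also have "\<dots> = L2_ip leb_pi f g'"
    unfolding L2_ip_def
  proof (rule integral_cong_AE)
    show "(\<lambda>t. f t * cnj (g' t)) \<in> borel_measurable leb_pi"
      using f g L2_measurable by measurable
    show "(\<lambda>t. (-\<i> * volterra f' t) * cnj (g' t)) \<in> borel_measurable leb_pi"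
      using L2_measurable[OF g(2)] vm(2) by measurable
    show "AE t in leb_pi. (-\<i> * volterra f' t) * cnj (g' t) = f t * cnj (g' t)"
      using FT_eq_mult_id_imp_volterra[OF f(2,1) eqf]
      by eventually_elim simp
  qed
  finally show ?thesis .
qed

subsection \<open>Completion of exponential systems\<close>

lemma FT_eq_L2_ip: "FT f z = L2_ip leb_pi f (\<lambda>t. cnj (expi z t))"
  by (simp add: FT_def L2_ip_def)

lemma FT_eq_L2_ip_cnj: "FT (\<lambda>t. cnj (f t)) z = cnj (L2_ip leb_pi f (expi z))"
  unfolding FT_def L2_ip_def
  by (subst Bochner_Integration.integral_cnj[symmetric]) simp

definition annihilator :: "complex set \<Rightarrow> (real \<Rightarrow> complex) set" where
  "annihilator \<Lambda> = {f \<in> L2_space leb_pi. \<forall>l\<in>\<Lambda>. FT f l = 0}"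

text \<open>\<open>k\<close> is \<open>u\<close> minus its projection onto the closed span of the
  conjugated exponentials, to which every element of the annihilator is orthogonal.\<close>

lemma annihilator_functional:
  assumes u: "u \<in> L2_space leb_pi"
  shows "\<exists>k\<in>annihilator \<Lambda>. \<forall>f\<in>annihilator \<Lambda>. L2_ip leb_pi f k = L2_ip leb_pi f u"
proof -
  let ?v = "\<lambda>l t. cnj (expi l t)"
  have v: "?v l \<in> L2_space leb_pi" for l by (rule L2_cnj[OF expi_in_L2])
  have "\<exists>p\<in>L2_closed_span leb_pi ?v \<Lambda>. \<forall>l\<in>\<Lambda>. L2_ip leb_pi (\<lambda>t. u t - p t) (?v l) = 0"
    by (rule L2_projection[OF v u])
  then obtain p where p: "p \<in> L2_closed_span leb_pi ?v \<Lambda>"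
    "\<And>l. l \<in> \<Lambda> \<Longrightarrow> L2_ip leb_pi (\<lambda>t. u t - p t) (?v l) = 0" by auto
  have pL: "p \<in> L2_space leb_pi" using p(1) by (simp add: L2_closed_span_def)
  have k: "(\<lambda>t. 1 * u t + (-1) * p t) \<in> annihilator \<Lambda>"
    using L2_lincomb[OF u pL, of 1 "-1"] p(2) by (simp add: annihilator_def FT_eq_L2_ip)
  have "L2_ip leb_pi f (\<lambda>t. 1 * u t + (-1) * p t) = L2_ip leb_pi f u" if f: "f \<in> annihilator \<Lambda>" for f
  proof -
    have fL: "f \<in> L2_space leb_pi" using f by (simp add: annihilator_def)
    have "L2_ip leb_pi f p = 0"
      by (rule L2_ip_closed_span_eq_0[OF v p(1) fL]) (use f in \<open>simp add: annihilator_def FT_eq_L2_ip\<close>)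
    then show ?thesis using L2.ip_lincomb_right[OF u pL fL, of 1 "-1"] by simp
  qed
  then show ?thesis using k by blast
qed

lemma annihilator_entire_hilbert:
  assumes f0: "f0 \<in> annihilator \<Lambda>" "\<not> (AE t in leb_pi. f0 t = 0)"
  shows "entire_hilbert (annihilator \<Lambda>) (L2_ip leb_pi) FT \<Lambda>"
proof
  have L2: "f \<in> L2_space leb_pi" if "f \<in> annihilator \<Lambda>" for f
    using that by (simp add: annihilator_def)
  show "(\<lambda>t. a * f t + b * g t) \<in> annihilator \<Lambda>"
    if "f \<in> annihilator \<Lambda>" "g \<in> annihilator \<Lambda>" for f g a b
    using that by (simp add: annihilator_def L2_lincomb FT_lincomb)
  show "L2_ip leb_pi (\<lambda>t. a * f t + b * g t) h = a * L2_ip leb_pi f h + b * L2_ip leb_pi g h"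
    if "f \<in> annihilator \<Lambda>" "g \<in> annihilator \<Lambda>" "h \<in> annihilator \<Lambda>" for f g h a b
    using that by (intro L2.ip_lincomb L2)
  show "L2_ip leb_pi g f = cnj (L2_ip leb_pi f g)"
    if "f \<in> annihilator \<Lambda>" "g \<in> annihilator \<Lambda>" for f g
    using that by (intro L2.ip_commute L2)
  show "0 \<le> Re (L2_ip leb_pi f f)" if "f \<in> annihilator \<Lambda>" for f
    using that by (intro L2.ip_nonneg L2)
  show "FT (\<lambda>t. a * f t + b * g t) z = a * FT f z + b * FT g z"
    if "f \<in> annihilator \<Lambda>" "g \<in> annihilator \<Lambda>" for f g a b z
    using that by (intro FT_lincomb L2)
  show "FT f holomorphic_on UNIV" if "f \<in> annihilator \<Lambda>" for f
    using that by (intro FT_holomorphic L2)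
  show "FT f z = 0" if "f \<in> annihilator \<Lambda>" "z \<in> \<Lambda>" for f z
    using that by (simp add: annihilator_def)
  show "\<exists>k\<in>annihilator \<Lambda>. \<forall>f\<in>annihilator \<Lambda>. L2_ip leb_pi f k = FT f z" for z
    unfolding FT_eq_L2_ip by (rule annihilator_functional[OF L2_cnj[OF expi_in_L2]])
  show "\<exists>k\<in>annihilator \<Lambda>. \<forall>f\<in>annihilator \<Lambda>. L2_ip leb_pi f k = deriv (FT f) z" for z
  proof -
    let ?u = "\<lambda>t. cnj (\<i> * of_real t * expi z t)"
    have "\<exists>k\<in>annihilator \<Lambda>. \<forall>f\<in>annihilator \<Lambda>. L2_ip leb_pi f k = L2_ip leb_pi f ?u"
      by (rule annihilator_functional[OF L2_cnj[OF L2_times_ii_id[OF expi_in_L2]]])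
    moreover have "L2_ip leb_pi f ?u = deriv (FT f) z" if "f \<in> annihilator \<Lambda>" for f
      unfolding deriv_FT[OF L2[OF that]] by (simp add: L2_ip_def FT_def mult_ac)
    ultimately show ?thesis by simp
  qed
  show "\<exists>g\<in>annihilator \<Lambda>. \<forall>z. FT f z = (z - w) * FT g z"
    if f: "f \<in> annihilator \<Lambda>" and w: "FT f w = 0" and d: "w \<in> \<Lambda> \<Longrightarrow> deriv (FT f) w = 0" for f w
  proof -
    obtain g where g: "g \<in> L2_space leb_pi" "\<And>z. (z - w) * FT g z = FT f z"
      using FT_volterra[OF L2[OF f] w] by auto
    have "FT g l = 0" if l: "l \<in> \<Lambda>" for l
    \<comment> \<open>Division by \<open>z - w\<close> lowers the order of the zero at
      \<open>w\<close>; if \<open>w \<in> \<Lambda>\<close>, the value there is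
      \<open>FT g w = deriv (FT f) w = 0\<close>.\<close>
    proof (cases "l = w")
      case True
      have "((\<lambda>z. (z - w) * FT g z) has_field_derivative FT g w) (at w)"
        by (auto intro!: derivative_eq_intros FT_has_derivative[OF g(1)])
      then have "deriv (FT f) w = FT g w" unfolding g(2) by (rule DERIV_imp_deriv)
      then show ?thesis using d l True by simp
    next
      case False
      then show ?thesis using g(2)[of l] f l by (simp add: annihilator_def)
    qed
    then have "g \<in> annihilator \<Lambda>" using g(1) by (simp add: annihilator_def)
    then show ?thesis using g(2) by (intro bexI[of _ g]) simp_all
  qed
  show "L2_ip leb_pi f' g = L2_ip leb_pi f g'"
    if "f \<in> annihilator \<Lambda>" "g \<in> annihilator \<Lambda>" "f' \<in> annihilator \<Lambda>" "g' \<in> annihilator \<Lambda>"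
      "\<And>z. FT f' z = z * FT f z" "\<And>z. FT g' z = z * FT g z" for f g f' g'
    by (rule FT_mult_id_symmetric) (use that L2 in auto)
  show "\<exists>f\<in>annihilator \<Lambda>. \<exists>z. FT f z \<noteq> 0"
    using FT_injective[OF L2[OF f0(1)]] f0 by blast
qed

lemma expi_completeI:
  assumes "\<And>f. f \<in> L2_space leb_pi \<Longrightarrow> (\<And>j. j \<in> J \<Longrightarrow> FT f j = 0) \<Longrightarrow> AE t in leb_pi. f t = 0"
  shows "L2_complete leb_pi expi J"
proof (rule L2_completeI[OF expi_in_L2])
  fix f assume f: "f \<in> L2_space leb_pi" and z: "\<And>j. j \<in> J \<Longrightarrow> L2_ip leb_pi f (expi j) = 0"
  have "AE t in leb_pi. cnj (f t) = 0"
    by (rule assms[OF L2_cnj[OF f]]) (simp add: FT_eq_L2_ip_cnj z)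
  then show "L2_norm leb_pi f = 0" by (simp add: L2_norm_eq_0_iff[OF f])
qed

lemma expi_minimalI:
  assumes "\<And>j. j \<in> J \<Longrightarrow> \<exists>f\<in>L2_space leb_pi. FT f j \<noteq> 0 \<and> (\<forall>i\<in>J-{j}. FT f i = 0)"
  shows "L2_minimal leb_pi expi J"
proof (rule L2_minimalI[OF expi_in_L2])
  fix j assume "j \<in> J"
  from assms[OF this] obtain f where f: "f \<in> L2_space leb_pi"
    "FT f j \<noteq> 0 \<and> (\<forall>i\<in>J-{j}. FT f i = 0)" ..
  have eq: "L2_ip leb_pi (\<lambda>t. cnj (f t)) (expi i) = cnj (FT f i)" for i
    using FT_eq_L2_ip_cnj[of "\<lambda>t. cnj (f t)" i] by simp
  show "\<exists>f\<in>L2_space leb_pi. L2_ip leb_pi f (expi j) \<noteq> 0 \<and> (\<forall>i\<in>J-{j}. L2_ip leb_pi f (expi i) = 0)"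
    by (rule bexI[where x="\<lambda>t. cnj (f t)"]) (use f L2_cnj[OF f(1)] in \<open>simp_all add: eq\<close>)
qed

theorem theorem1p1:
  fixes \<Lambda> :: "complex set"
  assumes "\<not> L2_complete leb_pi expi \<Lambda>"
  shows "\<exists>S::complex set. S \<subseteq> \<real> \<and> countable S \<and> \<Lambda> \<inter> S = {} \<and>
           L2_complete leb_pi expi (\<Lambda> \<union> S) \<and> L2_minimal leb_pi expi (\<Lambda> \<union> S)"
proof -
  \<comment> \<open>Incompleteness provides the nonzero annihilating function that makes the Hilbert
    space nontrivial.\<close>
  obtain f0 where f0: "f0 \<in> annihilator \<Lambda>" "\<not> (AE t in leb_pi. f0 t = 0)"
    using assms expi_completeI[of \<Lambda>] by (auto simp: annihilator_def)
  interpret entire_hilbert "annihilator \<Lambda>" "L2_ip leb_pi" FT \<Lambda>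
    by (rule annihilator_entire_hilbert[OF f0])
  obtain S where S: "S \<subseteq> \<real>" "countable S" "\<Lambda> \<inter> S = {}" "S \<noteq> {}"
    and uniq: "\<And>f z. f \<in> annihilator \<Lambda> \<Longrightarrow> \<forall>s\<in>S. FT f s = 0 \<Longrightarrow> FT f z = 0"
    and dual: "\<And>s. s \<in> S \<Longrightarrow> \<exists>f\<in>annihilator \<Lambda>. FT f s \<noteq> 0 \<and> (\<forall>s'\<in>S-{s}. FT f s' = 0)"
    using exists_real_uniqueness_set by metis
  have "L2_complete leb_pi expi (\<Lambda> \<union> S)"
  proof (rule expi_completeI)
    fix f assume f: "f \<in> L2_space leb_pi" and z: "\<And>j. j \<in> \<Lambda> \<union> S \<Longrightarrow> FT f j = 0"
    show "AE t in leb_pi. f t = 0"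
      by (rule FT_injective[OF f], rule uniq) (use f z in \<open>auto simp: annihilator_def\<close>)
  qed
  moreover have "L2_minimal leb_pi expi (\<Lambda> \<union> S)"
  proof (rule expi_minimalI)
    fix j assume j: "j \<in> \<Lambda> \<union> S"
    show "\<exists>f\<in>L2_space leb_pi. FT f j \<noteq> 0 \<and> (\<forall>i\<in>\<Lambda> \<union> S-{j}. FT f i = 0)"
    proof (cases "j \<in> S")
      case True
      from dual[OF this] obtain f where "f \<in> annihilator \<Lambda>"
        "FT f j \<noteq> 0 \<and> (\<forall>s'\<in>S-{j}. FT f s' = 0)" ..
      then show ?thesis by (intro bexI[where x=f]) (auto simp: annihilator_def)
    next
      case False
      then have jL: "j \<in> \<Lambda>" using j by simp
      \<comment> \<open>For \<open>j \<in> \<Lambda>\<close> the dual function at an arbitrary point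
        \<open>s\<close> of \<open>S\<close> is modified.\<close>
      obtain s where s: "s \<in> S" using S(4) by blast
      have sj: "s \<noteq> j" using s jL S(3) by blast
      from dual[OF s] obtain f where f: "f \<in> annihilator \<Lambda>"
        "FT f s \<noteq> 0 \<and> (\<forall>s'\<in>S-{s}. FT f s' = 0)" ..
      have fL: "f \<in> L2_space leb_pi" and fj: "FT f j = 0" using f(1) jL by (auto simp: annihilator_def)
      obtain g where g: "g \<in> L2_space leb_pi" "\<And>z. (z - j) * FT g z = FT f z"
        using FT_volterra[OF fL fj] by auto
      \<comment> \<open>On the Fourier side this trades the zero at \<open>j\<close> for one at \<open>s\<close>.\<close>
      define h where "h = (\<lambda>t. 1 * f t + (j - s) * g t)"
      have h: "h \<in> L2_space leb_pi" unfolding h_def by (rule L2_lincomb[OF fL g(1)])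
      have FTh: "FT h z = (z - s) * FT g z" for z
        unfolding h_def FT_lincomb[OF fL g(1)] by (simp add: algebra_simps flip: g(2))
      have h0: "FT h i = 0" if "i \<in> \<Lambda> \<union> S - {j}" for i
      proof (cases "i = s")
        case False
        then have "FT f i = 0" using that f by (auto simp: annihilator_def)
        then show ?thesis using g(2)[of i] that by (simp add: FTh)
      qed (simp add: FTh)
      \<comment> \<open>If \<open>FT h\<close> vanished at \<open>j\<close> too, it would vanish on
        all of \<open>\<Lambda> \<union> S\<close>, hence identically; then \<open>FT g\<close> and
        \<open>FT f\<close> would be 0, against \<open>FT f s \<noteq> 0\<close>.\<close>
      have "FT h j \<noteq> 0"
      proof
        assume "FT h j = 0"
        then have "h \<in> annihilator \<Lambda>" "\<forall>s\<in>S. FT h s = 0"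
          using h h0 False by (auto simp: annihilator_def)
        then have "FT h z = 0" for z by (rule uniq)
        then have "FT g z = 0" if "z \<noteq> s" for z using FTh[of z] that by simp
        then have "FT g s = 0" by (rule entire_eq_0I[OF FT_holomorphic[OF g(1)]])
        then show False using g(2)[of s] f(2) by simp
      qed
      then show ?thesis using h h0 by blast
    qed
  qed
  ultimately show ?thesis using S by blast
qed

end
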